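(* Let $k\ge 3$ and let $n$ be a positive integer. If there exists a pl-realizable $n_k$-configuration, then $n>k^2+k-5$. In particular, there is no pl-realizable $15_4$-configuration.
   Context: For $k\geq 3$, an $n_k$-configuration is a simple matroid $M$ of rank $3$ on $n$ elements (called points) such that every line (rank-2 flat) of $M$ contains at most $k$ points, and each point is contained in exactly $k$ lines that have exactly $k$ points. An arrangement of pseudolines is a finite family of simple closed non-contractible curves in the real projective plane, any two of which meet in exactly one point, where they cross transversally. An $n_k$-configuration $M$ is pl-realizable (realizable with pseudolines) if there is an arrangement of pseudolines having exactly the incidences prescribed by $M$: the arrangement consists of $n$ pseudolines labelled by the elements of $M$, and a set of these pseudolines has a common point if and only if the corresponding set of elements has rank at most $2$ in $M$. By the Folkman-Lawrence representation theorem this is equivalent to $M$ being orientable (i.e. $M$ is the underlying matroid of an oriented matroid). *)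

theory Defs
  imports "HOL-Analysis.Analysis"
begin

section \<open>Matroids and configurations\<close>

locale matroid =
  fixes E :: "'a set" and indep :: "'a set \<Rightarrow> bool"
  assumes finite_ground: "finite E"
    and indep_subset_ground: "indep X \<Longrightarrow> X \<subseteq> E"
    and indep_empty: "indep {}"
    and indep_subset: "indep X \<Longrightarrow> Y \<subseteq> X \<Longrightarrow> indep Y"
    and augmentation:
      "indep X \<Longrightarrow> indep Y \<Longrightarrow> card X < card Y \<Longrightarrow> \<exists>y\<in>Y - X. indep (insert y X)"

definition matroid_rank :: "('a set \<Rightarrow> bool) \<Rightarrow> 'a set \<Rightarrow> nat" where
  "matroid_rank indep X = Max {card I |I. I \<subseteq> X \<and> indep I}"

definition flat :: "'a set \<Rightarrow> ('a set \<Rightarrow> bool) \<Rightarrow> 'a set \<Rightarrow> bool" where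
  "flat E indep F \<longleftrightarrow>
     F \<subseteq> E \<and> (\<forall>x\<in>E - F. matroid_rank indep F < matroid_rank indep (insert x F))"

definition matroid_lines :: "'a set \<Rightarrow> ('a set \<Rightarrow> bool) \<Rightarrow> 'a set set" where
  "matroid_lines E indep = {L. flat E indep L \<and> matroid_rank indep L = 2}"

text \<open>Simple: no loops and no parallel elements (the case \<open>x = y\<close> excludes loops).\<close>

definition simple_matroid :: "'a set \<Rightarrow> ('a set \<Rightarrow> bool) \<Rightarrow> bool" where
  "simple_matroid E indep \<longleftrightarrow> matroid E indep \<and> (\<forall>x\<in>E. \<forall>y\<in>E. indep {x, y})"

definition nk_configuration :: "nat \<Rightarrow> nat \<Rightarrow> 'a set \<Rightarrow> ('a set \<Rightarrow> bool) \<Rightarrow> bool" where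
  "nk_configuration n k E indep \<longleftrightarrow>
     simple_matroid E indep \<and> matroid_rank indep E = 3 \<and> card E = n \<and>
     (\<forall>L\<in>matroid_lines E indep. card L \<le> k) \<and>
     (\<forall>x\<in>E. card {L \<in> matroid_lines E indep. x \<in> L \<and> card L = k} = k)"


section \<open>The real projective plane\<close>

text \<open>Pairs of antipodal points of the unit sphere, with the quotient topology.\<close>

typedef rp2 = "(\<lambda>x. {x, - x}) ` sphere (0 :: real ^ 3) 1"
  by (auto intro: exI[of _ "axis 1 1"])

definition rp2_of :: "real ^ 3 \<Rightarrow> rp2" where
  "rp2_of x = Abs_rp2 {x, - x}"

instantiation rp2 :: topological_space
begin

definition open_rp2 :: "rp2 set \<Rightarrow> bool" where
  "open_rp2 U \<longleftrightarrow> openin (top_of_set (sphere 0 1)) {x \<in> sphere 0 1. rp2_of x \<in> U}"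

instance
proof
  show "open (UNIV :: rp2 set)"
    by (simp only: open_rp2_def UNIV_I simp_thms Collect_mem_eq openin_subtopology_refl) simp
next
  fix S T :: "rp2 set"
  assume "open S" "open T"
  moreover have "{x \<in> sphere 0 1. rp2_of x \<in> S \<inter> T} =
      {x \<in> sphere 0 1. rp2_of x \<in> S} \<inter> {x \<in> sphere 0 1. rp2_of x \<in> T}"
    by auto
  ultimately show "open (S \<inter> T)"
    unfolding open_rp2_def by (simp only: openin_Int)
next
  fix K :: "rp2 set set"
  assume K: "\<forall>S\<in>K. open S"
  have "{x \<in> sphere 0 1. rp2_of x \<in> \<Union>K} = \<Union>((\<lambda>S. {x \<in> sphere 0 1. rp2_of x \<in> S}) ` K)"
    by auto
  moreover have "openin (top_of_set (sphere 0 1))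
      (\<Union>((\<lambda>S. {x \<in> sphere 0 1. rp2_of x \<in> S}) ` K))"
    using K unfolding open_rp2_def by (blast intro: openin_Union)
  ultimately show "open (\<Union>K)"
    unfolding open_rp2_def by (simp only:)
qed

end


section \<open>Pseudolines\<close>

definition pseudoline :: "(real \<Rightarrow> rp2) \<Rightarrow> bool" where
  "pseudoline g \<longleftrightarrow>
     simple_path g \<and> pathfinish g = pathstart g \<and> \<not> (\<exists>a. homotopic_loops UNIV g (\<lambda>_. a))"

text \<open>Pseudolines need not be smooth, so transversality is topological: in a suitable chart
  the two curves are the coordinate axes, and \<open>p\<close> is the origin.\<close>

definition cross_at :: "rp2 set \<Rightarrow> rp2 set \<Rightarrow> rp2 \<Rightarrow> bool" where
  "cross_at A B p \<longleftrightarrow>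
     (\<exists>U h h'. open U \<and> homeomorphism U (UNIV :: (real \<times> real) set) h h' \<and>
        p \<in> U \<and> h p = (0, 0) \<and> h ` (A \<inter> U) = UNIV \<times> {0} \<and> h ` (B \<inter> U) = {0} \<times> UNIV)"

definition pseudoline_arrangement :: "'a set \<Rightarrow> ('a \<Rightarrow> real \<Rightarrow> rp2) \<Rightarrow> bool" where
  "pseudoline_arrangement I c \<longleftrightarrow>
     finite I \<and> (\<forall>i\<in>I. pseudoline (c i)) \<and>
     (\<forall>i\<in>I. \<forall>j\<in>I. i \<noteq> j \<longrightarrow>
        (\<exists>p. path_image (c i) \<inter> path_image (c j) = {p} \<and>
             cross_at (path_image (c i)) (path_image (c j)) p))"

definition pl_realizable :: "'a set \<Rightarrow> ('a set \<Rightarrow> bool) \<Rightarrow> bool" where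
  "pl_realizable E indep \<longleftrightarrow>
     (\<exists>c. pseudoline_arrangement E c \<and>
        (\<forall>S\<subseteq>E. (\<exists>p. \<forall>i\<in>S. p \<in> path_image (c i)) \<longleftrightarrow> matroid_rank indep S \<le> 2))"

end

(*
Write n for the number of pseudolines. Counting pairs of pseudolines through their crossing
points gives sum |L| (|L| - 1) = n (n - 1), where L runs over the matroid lines, and exactly n
of these have k points. Melchior's inequality sum |L| <= 3 #lines - 3 makes the sum of the terms
|L| (|L| - 1) + 2 |L| - 6, none of which is negative, at most n (n - 1) - 6. Keeping the k-point
lines only, n (k^2 + k - 6) < n (n - 1).

Melchior's inequality is proved on the double cover by the 2-sphere, where a pseudoline lifts to
a centrally symmetric Jordan curve. Its two sides are exchanged by the antipodal map, because
another pseudoline crosses it. A cell is represented by its vector of signs; inserting the curves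
one at a time shows that there are at least 2 + sum_v (deg v - 1) sign vectors, which replaces
Euler's formula. By Janiszewski's theorem the lune cut out by two curves is connected, so that a
cell with at most two walls would fill a lune and all curves would pass through its two corners.
Hence every cell has at least three walls, and double counting the walls gives the inequality.
*)
theory Submission
  imports Defs
begin

section \<open>Separation on the sphere\<close>

text \<open>Inequalities suffice, which is why sign vectors can stand for cells. On the sphere,
  three walls per cell and two cells per edge give 3 cells <= 2 edges. Each curve has as many edges
  as vertices, so there are sum deg edges in all. With cells >= 2 + sum (deg - 1), eliminating the
  cells leaves sum deg + 6 <= 3 #vertices, and antipodal pairs halve this to the projective
  inequality with its 3. The obstacle is that pseudolines are merely continuous and that crossing is
  given only in a chart around a single point. All of its global content is condensed into one fact:
  the side function of a lifted curve is odd. From then on every change of sign along a curve comes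
  from comparing a point with its antipode. For a line with m points the weight m (m - 1) + 2 m - 6
  equals (m - 2) (m + 3). It is the pair count plus twice the term m - 3 of Melchior's inequality,
  and it vanishes exactly at simple crossings.\<close>

definition S2 :: "(real ^ 3) set" where
  "S2 = sphere 0 1"

lemma minus_S2 [simp]: "- x \<in> S2 \<longleftrightarrow> x \<in> S2"
  by (simp add: S2_def)

lemma S2_nonzero: "x \<in> S2 \<Longrightarrow> x \<noteq> 0"
  by (auto simp: S2_def)

lemma S2_neq_minus: "x \<in> S2 \<Longrightarrow> x \<noteq> - x"
  using S2_nonzero[of x] by (simp add: eq_neg_iff_add_eq_0 flip: scaleR_2)

lemma connected_S2: "connected S2"
  unfolding S2_def by (rule connected_sphere) simp

section \<open>Plane topology carried to the sphere by stereographic projection\<close>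

lemma stereographic:
  assumes "N \<in> S2"
  obtains f f' where "homeomorphism (S2 - {N}) (UNIV :: complex set) f f'"
proof -
  have "(sphere 0 1 - {N}) homeomorphic (UNIV :: complex set)"
    by (rule homeomorphic_punctured_sphere_affine) (use assms in \<open>auto simp: S2_def\<close>)
  then show ?thesis using that unfolding homeomorphic_def S2_def by blast
qed

lemma openin_S2_delete: "openin (top_of_set S2) (S2 - {N})"
  by (metis Diff_eq closed_singleton open_Compl openin_open_Int)

lemma stereographic_open:
  assumes "homeomorphism (S2 - {N}) (UNIV :: complex set) f f'" "L \<subseteq> S2 - {N}"
  shows "openin (top_of_set S2) L \<longleftrightarrow> open (f ` L)"
proof -
  have "openin (top_of_set S2) L \<longleftrightarrow> openin (top_of_set (S2 - {N})) L"
    using assms(2) openin_S2_delete by (metis Diff_subset openin_subset_trans openin_trans)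
  also have "\<dots> \<longleftrightarrow> open (f ` L)"
  proof
    assume "openin (top_of_set (S2 - {N})) L"
    then show "open (f ` L)" using homeomorphism_imp_open_map[OF assms(1)] by fastforce
  next
    assume "open (f ` L)"
    then have "openin (top_of_set (S2 - {N})) (f' ` f ` L)"
      using homeomorphism_imp_open_map[OF homeomorphism_symD[OF assms(1)]] by simp
    moreover have "f' (f x) = x" if "x \<in> L" for x
      using assms that by (auto simp: homeomorphism_def)
    then have "f' ` f ` L = L" by (simp add: image_image)
    ultimately show "openin (top_of_set (S2 - {N})) L" by simp
  qed
  finally show ?thesis .
qed

text \<open>A point outside \<open>L\<close> serves as projection centre, and in the plane a
  connected open set stays connected when finitely many points are removed.\<close>

lemma connected_S2_delete_finite:
  assumes "openin (top_of_set S2) L" "connected L" "L \<noteq> S2" "finite V"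
  shows "connected (L - V)"
proof -
  obtain N where N: "N \<in> S2" "N \<notin> L" using assms openin_imp_subset by blast
  obtain f f' where f: "homeomorphism (S2 - {N}) (UNIV :: complex set) f f'"
    using stereographic N by blast
  have L: "L \<subseteq> S2 - {N}" using N openin_imp_subset[OF assms(1)] by auto
  have cf: "continuous_on (S2 - {N}) f" "continuous_on UNIV f'" and inv: "\<And>x. x \<in> S2 - {N} \<Longrightarrow> f' (f x) = x"
    using f by (auto simp: homeomorphism_def)
  have "connected (f ` L)" using cf L assms(2) by (meson connected_continuous_image continuous_on_subset)
  moreover have "open (f ` L)" using stereographic_open[OF f L] assms(1) by simp
  ultimately have "connected (f ` L - f ` (V \<inter> L))"
    using assms(4) by (intro connected_open_delete_finite) auto
  then have "connected (f' ` (f ` L - f ` (V \<inter> L)))"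
    using cf(2) by (meson connected_continuous_image continuous_on_subset subset_UNIV)
  moreover have "inj_on f L" using inv L by (metis inj_on_def subsetD)
  then have "f ` L - f ` (V \<inter> L) = f ` (L - V)" by (auto simp: inj_on_def)
  moreover have "f' ` f ` (L - V) = L - V" using inv L by (force simp: image_iff)
  ultimately show ?thesis by simp
qed

text \<open>The plane version wants one compact and one closed set, so the projection centre
  \<open>N\<close> is taken in \<open>B\<close> but not in \<open>A\<close>: \<open>A\<close>
  becomes compact, and \<open>B\<close> without \<open>N\<close> stays closed. The intersection is
  untouched, and \<open>S2 - A\<close> stays connected without \<open>N\<close> because it is a
  proper open subset. If no such \<open>N\<close> exists, or \<open>A\<close> is empty, the union is
  one of the two sets.\<close>

lemma Janiszewski_S2:
  assumes A: "closed A" "A \<subseteq> S2" "connected (S2 - A)" and B: "closed B" "B \<subseteq> S2" "connected (S2 - B)"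
    and AB: "connected (A \<inter> B)"
  shows "connected (S2 - (A \<union> B))"
proof (cases "B \<subseteq> A \<or> A = {}")
  case True
  then show ?thesis using A B by (auto simp: Un_absorb2)
next
  case False
  then obtain N where N: "N \<in> B" "N \<notin> A" by auto
  obtain f f' where f: "homeomorphism (S2 - {N}) (UNIV :: complex set) f f'"
    using stereographic N B by blast
  have cf: "continuous_on (S2 - {N}) f" "continuous_on UNIV f'"
    and inv: "\<And>x. x \<in> S2 - {N} \<Longrightarrow> f' (f x) = x" "\<And>x. f (f' x) = x"
    and im: "f ` (S2 - {N}) = UNIV" "range f' = S2 - {N}"
    using f by (auto simp: homeomorphism_def)
  have inj: "inj_on f (S2 - {N})" using inv by (metis inj_on_def)
  have compl: "- f ` X = f ` (S2 - {N} - X)" if "X \<subseteq> S2 - {N}" for X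
    using im(1) inj_on_image_set_diff[OF inj _ that, of "S2 - {N}"] by (simp add: Compl_eq_Diff_UNIV)
  have conn: "connected (f ` X)" if "connected X" "X \<subseteq> S2 - {N}" for X
    using that cf by (meson connected_continuous_image continuous_on_subset)
  have AS: "A \<subseteq> S2 - {N}" "B - {N} \<subseteq> S2 - {N}" using A B N by auto
  have S2_Diff: "openin (top_of_set S2) (S2 - X)" if "closed X" for X
    using that by (metis Diff_eq open_Compl openin_open_Int)
  have "compact A" using A by (metis S2_def compact_Int_closed compact_sphere inf.absorb_iff2)
  then have 1: "compact (f ` A)" using AS cf by (meson compact_continuous_image continuous_on_subset)
  have "open (f ` (S2 - B))"
    using stereographic_open[OF f, of "S2 - B"] S2_Diff[OF B(1)] N by auto
  moreover have "- f ` (B - {N}) = f ` (S2 - B)" using compl[OF AS(2)] N by (simp add: Diff_insert_absorb set_diff_eq) (metis N(1))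
  ultimately have 2: "closed (f ` (B - {N}))" by (simp add: closed_def)
  have 3: "connected (- f ` (B - {N}))"
    using \<open>- f ` (B - {N}) = f ` (S2 - B)\<close> conn[OF B(3)] N by auto
  have "connected (S2 - A - {N})"
    by (rule connected_S2_delete_finite) (use A S2_Diff False in auto)
  then have 4: "connected (- f ` A)" using compl[OF AS(1)] conn[of "S2 - A - {N}"]
    by (metis Diff_mono Diff_subset Diff_insert Diff_insert2 order_refl)
  have "f ` A \<inter> f ` (B - {N}) = f ` (A \<inter> B)" using inj AS N by (auto simp: inj_on_def)
  then have 5: "connected (f ` A \<inter> f ` (B - {N}))" using conn[OF AB] AS by auto
  have "connected (- (f ` A \<union> f ` (B - {N})))"
    using Janiszewski_connected[OF 1 2 5 4 3] .
  then have "connected (f' ` (- (f ` A \<union> f ` (B - {N}))))"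
    using cf(2) by (meson connected_continuous_image continuous_on_subset subset_UNIV)
  moreover have "- (f ` A \<union> f ` (B - {N})) = f ` (S2 - (A \<union> B))"
    using compl[of "A \<union> (B - {N})"] AS N
    by (metis (no_types, lifting) Diff_insert2 Un_Diff_cancel Un_commute Un_subset_iff image_Un insert_Diff insert_is_Un sup_assoc)
  moreover have "f' ` f ` (S2 - (A \<union> B)) = S2 - (A \<union> B)" using inv N by (force simp: image_iff)
  ultimately show ?thesis by simp
qed

text \<open>Seen from a point \<open>N\<close> off the curve, one side is the preimage of the
  bounded plane component, the other is the preimage of the unbounded one with \<open>N\<close> put
  back. The last conclusion records that the curve is the frontier of both.\<close>

lemma Jordan_S2:
  assumes c: "simple_path c" "pathfinish c = pathstart c" "path_image c \<subseteq> S2" "path_image c \<noteq> S2"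
  obtains U V where "openin (top_of_set S2) U" "openin (top_of_set S2) V" "connected U" "connected V"
    "U \<inter> V = {}" "U \<union> V = S2 - path_image c"
    "\<And>x W. x \<in> path_image c \<Longrightarrow> openin (top_of_set S2) W \<Longrightarrow> x \<in> W \<Longrightarrow> W \<inter> U \<noteq> {} \<and> W \<inter> V \<noteq> {}"
proof -
  let ?C = "path_image c"
  obtain N where N: "N \<in> S2" "N \<notin> ?C" using c by auto
  obtain f f' where f: "homeomorphism (S2 - {N}) (UNIV :: complex set) f f'"
    using stereographic N by blast
  have cf: "continuous_on (S2 - {N}) f" "continuous_on UNIV f'"
    and inv: "\<And>x. x \<in> S2 - {N} \<Longrightarrow> f' (f x) = x" "\<And>x. f (f' x) = x"
    and im: "f ` (S2 - {N}) = UNIV" "range f' = S2 - {N}"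
    using f by (auto simp: homeomorphism_def)
  have inj: "inj_on f (S2 - {N})" using inv by (metis inj_on_def)
  have CN: "?C \<subseteq> S2 - {N}" using c N by auto
  have pim: "path_image (f \<circ> c) = f ` ?C" by (simp add: path_image_compose)
  have "simple_path (f \<circ> c)"
    by (rule simple_path_continuous_image) (use c cf CN inj in \<open>auto intro: continuous_on_subset inj_on_subset\<close>)
  moreover have "pathfinish (f \<circ> c) = pathstart (f \<circ> c)"
    using c by (simp add: pathfinish_compose pathstart_compose)
  ultimately obtain inner outer where io:
    "inner \<noteq> {}" "open inner" "connected inner" "outer \<noteq> {}" "open outer" "connected outer"
    "bounded inner" "\<not> bounded outer" "inner \<inter> outer = {}"
    "inner \<union> outer = - f ` ?C" "frontier inner = f ` ?C" "frontier outer = f ` ?C"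
    unfolding pim[symmetric] using Jordan_curve by blast
  have ff': "f ` f' ` X = X" for X using inv(2) by (simp add: image_image)
  have fX: "f' ` X \<subseteq> S2 - {N}" for X using im by auto
  define U where "U = f' ` inner"
  define V0 where "V0 = f' ` outer"
  have oU: "openin (top_of_set S2) U" "openin (top_of_set S2) V0"
    unfolding U_def V0_def using stereographic_open[OF f fX] io by (simp_all add: ff')
  have conn: "connected U" "connected V0"
    unfolding U_def V0_def using io cf(2) by (meson connected_continuous_image continuous_on_subset subset_UNIV)+
  have f'C: "f' ` f ` ?C = ?C" using inv CN by (force simp: image_iff)
  have part: "U \<union> V0 \<union> ?C = S2 - {N}"
  proof -
    have "U \<union> V0 \<union> ?C = f' ` (inner \<union> outer \<union> f ` ?C)" by (simp add: U_def V0_def image_Un f'C)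
    also have "inner \<union> outer \<union> f ` ?C = UNIV" using io(10) by auto
    finally show ?thesis using im by simp
  qed
  have inj': "inj f'" using inv(2) by (metis injI)
  have disj: "U \<inter> V0 = {}" "U \<inter> ?C = {}" "V0 \<inter> ?C = {}"
  proof -
    show "U \<inter> V0 = {}" using io(9) inj' by (auto simp: U_def V0_def dest: injD)
    have "f' ` (inner \<union> outer) \<inter> f' ` f ` ?C = {}" using io(10) inj' by (auto dest: injD)
    then show "U \<inter> ?C = {}" "V0 \<inter> ?C = {}" unfolding f'C U_def V0_def by auto
  qed
  have "inner \<union> f ` ?C = closure inner" using io(11) by (metis closure_Un_frontier)
  then have "compact (inner \<union> f ` ?C)" using io(7) by simp
  then have "compact (f' ` (inner \<union> f ` ?C))"
    using cf(2) by (meson compact_continuous_image continuous_on_subset subset_UNIV)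
  then have "closed (U \<union> ?C)" by (simp add: image_Un f'C U_def compact_imp_closed)
  moreover have "insert N V0 = S2 \<inter> - (U \<union> ?C)"
    using part disj N fX[of inner] by (auto simp: U_def)
  ultimately have oV: "openin (top_of_set S2) (insert N V0)"
    by (metis open_Compl openin_open_Int)
  have "N \<in> closure V0"
  proof (rule ccontr)
    \<comment> \<open>Then the closure of \<open>V0\<close> would be compact and within the domain
      of \<open>f\<close>, so \<open>outer\<close> would be bounded.\<close>
    assume n: "N \<notin> closure V0"
    have "V0 \<subseteq> S2" using part by auto
    then have cl: "closure V0 \<subseteq> S2" by (simp add: S2_def closure_minimal)
    then have "compact (closure V0)"
      by (metis S2_def closed_closure compact_Int_closed compact_sphere inf.absorb_iff2)
    moreover have "continuous_on (closure V0) f"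
      by (rule continuous_on_subset[OF cf(1)]) (use cl n in auto)
    ultimately have "bounded (f ` closure V0)"
      using compact_continuous_image compact_imp_bounded by blast
    then have "bounded (f ` V0)" by (rule bounded_subset) (simp add: closure_subset image_mono)
    then show False using io(8) by (simp add: V0_def ff')
  qed
  then have "insert N V0 \<subseteq> closure V0" using closure_subset by blast
  then have cV: "connected (insert N V0)"
    by (rule connected_intermediate_closure[OF conn(2) subset_insertI])
  have dense: "W \<inter> U \<noteq> {} \<and> W \<inter> V0 \<noteq> {}"
    if x: "x \<in> ?C" and W: "openin (top_of_set S2) W" "x \<in> W" for x W
  proof -
    have WS: "W - {N} \<subseteq> S2 - {N}" using openin_imp_subset[OF W(1)] by auto
    then have "W - {N} = W \<inter> (S2 - {N})" by auto
    then have oW: "openin (top_of_set S2) (W - {N})"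
      using openin_Int[OF W(1) openin_S2_delete] by simp
    have op: "open (f ` (W - {N}))" using stereographic_open[OF f WS] oW by simp
    have fx: "f x \<in> f ` (W - {N})" using x W N by auto
    have "f x \<in> closure inner" "f x \<in> closure outer" using x io(11,12) by (auto simp: frontier_def)
    then have "f ` (W - {N}) \<inter> inner \<noteq> {}" "f ` (W - {N}) \<inter> outer \<noteq> {}"
      using op fx open_Int_closure_eq_empty by blast+
    then obtain y z where y: "y \<in> W - {N}" "f y \<in> inner" and z: "z \<in> W - {N}" "f z \<in> outer" by auto
    have "y \<in> U" "z \<in> V0" unfolding U_def V0_def using y z inv(1) WS by (metis imageI subsetD)+
    then show ?thesis using y z by auto
  qed
  show ?thesis
  proof (rule that[of U "insert N V0"])
    show "U \<inter> insert N V0 = {}" using disj part by auto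
    show "U \<union> insert N V0 = S2 - ?C" using disj part N by auto
  qed (use oU oV conn cV dense in auto)
qed

text \<open>An intermediate value theorem for a function that is not continuous: off its zero set,
  the levels 1 and -1 are disjoint and relatively open, and \<open>K\<close> cannot meet
  both.\<close>

lemma sign_const_on_connected:
  fixes s :: "real ^ 3 \<Rightarrow> int"
  assumes "\<And>e. e \<noteq> 0 \<Longrightarrow> openin (top_of_set S2) {x \<in> S2. s x = e}"
    and "\<And>x. x \<in> S2 \<Longrightarrow> s x \<in> {-1, 0, 1}"
    and K: "connected K" "K \<subseteq> S2" "\<And>x. x \<in> K \<Longrightarrow> s x \<noteq> 0" "x \<in> K" "y \<in> K"
  shows "s x = s y"
proof -
  obtain U where U: "open U" "{x \<in> S2. s x = 1} = S2 \<inter> U"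
    using assms(1)[of 1] by (auto simp: openin_open)
  obtain V where V: "open V" "{x \<in> S2. s x = -1} = S2 \<inter> V"
    using assms(1)[of "-1"] by (auto simp: openin_open)
  have 1: "z \<in> U \<longleftrightarrow> s z = 1" "z \<in> V \<longleftrightarrow> s z = -1" "z \<in> U \<or> z \<in> V" if "z \<in> K" for z
    using U V K(2) K(3)[OF that] that assms(2)[of z] by (auto simp: set_eq_iff)
  have "U \<inter> V \<inter> K = {}" using 1 by fastforce
  then have "U \<inter> K = {} \<or> V \<inter> K = {}"
    using connectedD[OF K(1) U(1) V(1)] 1(3) by auto
  then show ?thesis using 1 K by (metis disjoint_iff)
qed

section \<open>Arrangements of centrally symmetric curves on the sphere\<close>

text \<open>\<open>gam i\<close> runs once through a lift of the projective curve, which is half of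
  a centrally symmetric Jordan curve; the antipodal half completes it, whence \<open>gam_1\<close>
  and the half-open parameter range. \<open>sg i\<close> tells the side, and \<open>sg_dense\<close>
  makes the curve border on both sides. That curves cross where they meet is not an axiom:
  \<open>signs_along_curve\<close> derives it from oddness.\<close>

locale spherical_arrangement =
  fixes I :: "'a set" and sg :: "'a \<Rightarrow> real ^ 3 \<Rightarrow> int" and gam :: "'a \<Rightarrow> real \<Rightarrow> real ^ 3"
  assumes finite_I: "finite I"
    and sg_values: "i \<in> I \<Longrightarrow> x \<in> S2 \<Longrightarrow> sg i x \<in> {-1, 0, 1}"
    and sg_minus: "i \<in> I \<Longrightarrow> x \<in> S2 \<Longrightarrow> sg i (- x) = - sg i x"
    and sg_open: "i \<in> I \<Longrightarrow> e \<noteq> 0 \<Longrightarrow> openin (top_of_set S2) {x \<in> S2. sg i x = e}"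
    and sg_dense: "\<lbrakk>i \<in> I; x \<in> S2; sg i x = 0; openin (top_of_set S2) W; x \<in> W; e \<in> {-1, 1}\<rbrakk>
                     \<Longrightarrow> \<exists>y\<in>W. sg i y = e"
    and gam_cont: "i \<in> I \<Longrightarrow> continuous_on {0..1} (gam i)"
    and gam_S2: "i \<in> I \<Longrightarrow> t \<in> {0..1} \<Longrightarrow> gam i t \<in> S2"
    and gam_1: "i \<in> I \<Longrightarrow> gam i 1 = - gam i 0"
    and gam_inj: "\<lbrakk>i \<in> I; s \<in> {0..<1}; t \<in> {0..<1}; gam i s = gam i t \<or> gam i s = - gam i t\<rbrakk> \<Longrightarrow> s = t"
    and zero_set: "i \<in> I \<Longrightarrow> {x \<in> S2. sg i x = 0} = gam i ` {0..<1} \<union> uminus ` gam i ` {0..<1}"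
    and meet: "\<lbrakk>i \<in> I; j \<in> I; i \<noteq> j\<rbrakk> \<Longrightarrow> \<exists>p\<in>S2. {x \<in> S2. sg i x = 0 \<and> sg j x = 0} = {p, - p}"
    and side_connected: "i \<in> I \<Longrightarrow> e \<noteq> 0 \<Longrightarrow> connected {x \<in> S2. sg i x = e}"
begin

section \<open>Sign changes along a curve\<close>

lemma sg_connected:
  assumes "i \<in> I" "connected K" "K \<subseteq> S2" "\<And>x. x \<in> K \<Longrightarrow> sg i x \<noteq> 0" "x \<in> K" "y \<in> K"
  shows "sg i x = sg i y"
  by (rule sign_const_on_connected[OF sg_open sg_values]) (use assms in auto)

lemma gam_zero: "i \<in> I \<Longrightarrow> t \<in> {0..<1} \<Longrightarrow> sg i (gam i t) = 0"
  using zero_set by fastforce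

lemma gam_nz: "i \<in> I \<Longrightarrow> t \<in> {0..1} \<Longrightarrow> gam i t \<noteq> 0"
  using gam_S2 S2_nonzero by blast

definition "crossing_time l j = (THE t. t \<in> {0..<1} \<and> sg j (gam l t) = 0)"

text \<open>The common points form one antipodal pair, and on the half-open interval
  \<open>gam l\<close> visits exactly one point of each antipodal pair of its curve.\<close>

lemma crossing_time_ex1:
  assumes "l \<in> I" "j \<in> I" "l \<noteq> j"
  shows "\<exists>!t. t \<in> {0..<1} \<and> sg j (gam l t) = 0"
proof -
  obtain p where p: "p \<in> S2" "{x \<in> S2. sg l x = 0 \<and> sg j x = 0} = {p, - p}"
    using meet[OF assms] by auto
  then have "p \<in> {x \<in> S2. sg l x = 0}" by auto
  then obtain t where t: "t \<in> {0..<1}" "p = gam l t \<or> p = - gam l t"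
    using zero_set[OF assms(1)] by blast
  have "gam l t \<in> {p, -p}" using t by auto
  then have 1: "sg j (gam l t) = 0" using p by blast
  have "u = t" if "u \<in> {0..<1}" "sg j (gam l u) = 0" for u
  proof -
    have "gam l u \<in> {x \<in> S2. sg l x = 0 \<and> sg j x = 0}"
      using that gam_zero[OF assms(1)] gam_S2[OF assms(1)] by auto
    then have "gam l u = p \<or> gam l u = - p" using p by auto
    then show ?thesis using gam_inj[OF assms(1) that(1) t(1)] t(2) by auto
  qed
  then show ?thesis using t(1) 1 by blast
qed

lemma crossing_time:
  assumes "l \<in> I" "j \<in> I" "l \<noteq> j"
  shows "crossing_time l j \<in> {0..<1}" "sg j (gam l (crossing_time l j)) = 0"
    "\<And>t. t \<in> {0..<1} \<Longrightarrow> sg j (gam l t) = 0 \<Longrightarrow> t = crossing_time l j"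
  using theI'[OF crossing_time_ex1[OF assms]] crossing_time_ex1[OF assms]
  unfolding crossing_time_def by blast+

text \<open>The end points of \<open>gam l\<close> are antipodal, hence on opposite sides of
  \<open>j\<close> or both on \<open>j\<close>. Since the sign vanishes only once, it has to change
  there.\<close>

lemma signs_along_curve:
  assumes "l \<in> I" "j \<in> I" "l \<noteq> j"
  shows "\<exists>d\<in>{-1, 1}. \<forall>t\<in>{0..<1}. sg j (gam l t) =
    (if t = crossing_time l j then 0 else if t < crossing_time l j then - d else d)"
proof -
  let ?c = "crossing_time l j"
  note c = crossing_time[OF assms]
  have c0: "0 \<le> ?c" "?c < 1" using c(1) by auto
  have nz1: "sg j (gam l 1) = - sg j (gam l 0)"
    using gam_1 sg_minus assms gam_S2[OF assms(1), of 0] by auto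
  have nz: "sg j (gam l t) \<noteq> 0" if "0 \<le> t" "t < 1" "t \<noteq> ?c" for t
    using c(3)[of t] that by auto
  define m where "m = (?c + 1) / 2"
  have m: "?c < m" "m < 1" using c0 by (auto simp: m_def)
  define d where "d = sg j (gam l m)"
  have "sg j (gam l m) \<noteq> 0" using nz m c0 by auto
  then have d: "d \<in> {-1, 1}"
    using sg_values[OF assms(2) gam_S2[OF assms(1)], of m] m c0 unfolding d_def by fastforce
  have *: "sg j (gam l t) = sg j (gam l u)"
    if "connected K" "t \<in> K" "u \<in> K" "K \<subseteq> {0..1}" "\<And>t. t \<in> K \<Longrightarrow> sg j (gam l t) \<noteq> 0" for t u K
    by (rule sg_connected[OF assms(2), of "gam l ` K"])
      (use that assms gam_S2 in \<open>auto intro!: connected_continuous_image continuous_on_subset[OF gam_cont]\<close>)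
  have after: "sg j (gam l t) = d" if "?c < t" "t < 1" for t
    unfolding d_def by (rule *[of "{?c<..<1}"]) (use that m c0 nz in auto)
  have before: "sg j (gam l t) = -d" if "0 \<le> t" "t < ?c" for t
  proof -
    have "sg j (gam l t) = sg j (gam l 0)"
      by (rule *[of "{0..<?c}"]) (use that c0 nz in auto)
    moreover have "sg j (gam l 0) \<noteq> 0" using nz[of 0] that c0 by auto
    \<comment> \<open>The parameter 1 lies outside the range of \<open>crossing_time\<close>; there
      the sign is nonzero because it is so at the antipode \<open>gam l 0\<close>.\<close>
    then have "sg j (gam l t) \<noteq> 0" if "t \<in> {?c<..1}" for t
      using nz[of t] that c0 nz1 by (cases "t = 1") auto
    then have "sg j (gam l 1) = d"
      unfolding d_def by (intro *[of "{?c<..1}"]) (use m c0 in auto)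
    ultimately show ?thesis using nz1 by auto
  qed
  show ?thesis using d after before c(2) by (intro bexI[of _ d]) auto
qed

section \<open>Connectedness of lunes\<close>

lemma sides_closed: "i \<in> I \<Longrightarrow> e \<noteq> 0 \<Longrightarrow> closed {x \<in> S2. sg i x \<noteq> e}"
proof -
  assume "i \<in> I" "e \<noteq> 0"
  then have "closedin (top_of_set S2) (S2 - {x \<in> S2. sg i x = e})"
    by (intro closedin_diff) (auto intro: sg_open)
  moreover have "S2 - {x \<in> S2. sg i x = e} = {x \<in> S2. sg i x \<noteq> e}" by auto
  moreover have "closed S2" by (simp add: S2_def)
  ultimately show ?thesis using closedin_closed_trans by metis
qed

text \<open>The set is a closed arc from one crossing point with \<open>j\<close> to its antipode.
  It is \<open>gam i\<close> from the crossing time to 1, continued by the antipodal path from 0 to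
  the crossing time; the two pieces join because \<open>gam i 1\<close> is \<open>- gam i 0\<close>.
  The other value of \<open>e\<close> gives the antipodal arc.\<close>

lemma half_curve_connected:
  assumes I: "i \<in> I" "j \<in> I" "i \<noteq> j" and e: "e \<in> {-1, 1}"
  shows "connected {x \<in> S2. sg i x = 0 \<and> sg j x \<noteq> e}"
proof -
  let ?t = "crossing_time i j"
  obtain d where d: "d \<in> {-1, 1}" and sd: "\<And>t. t \<in> {0..<1} \<Longrightarrow> sg j (gam i t) =
      (if t = ?t then 0 else if t < ?t then - d else d)"
    using signs_along_curve[OF I] by blast
  have t: "?t \<in> {0..<1}" using crossing_time(1)[OF I] .
  define H where "H = gam i ` {?t..1} \<union> (\<lambda>t. - gam i t) ` {0..?t}"
  have "connected (gam i ` {?t..1})" "connected ((\<lambda>t. - gam i t) ` {0..?t})"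
    by (rule connected_continuous_image;
        use t in \<open>auto intro!: continuous_intros continuous_on_subset[OF gam_cont[OF I(1)]]\<close>)+
  moreover have "gam i 1 \<in> gam i ` {?t..1}" using t by auto
  moreover have "- gam i 0 \<in> (\<lambda>t. - gam i t) ` {0..?t}" using t by auto
  ultimately have cH: "connected H"
    unfolding H_def by (intro connected_Un) (use gam_1[OF I(1)] in auto)
  have S: "gam i t \<in> S2" if "t \<in> {0..1}" for t using gam_S2[OF I(1) that] .
  have gm: "sg j (- gam i t) = - sg j (gam i t)" if "t \<in> {0..<1}" for t
    using sg_minus[OF I(2)] S that by auto
  have g1: "gam i 1 = - gam i 0" using gam_1 I by simp
  have HZ: "{x \<in> S2. sg i x = 0 \<and> sg j x \<noteq> - d} = H"
  proof
    show "{x \<in> S2. sg i x = 0 \<and> sg j x \<noteq> - d} \<subseteq> H"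
    proof
      fix x assume x: "x \<in> {x \<in> S2. sg i x = 0 \<and> sg j x \<noteq> - d}"
      then have "x \<in> {x \<in> S2. sg i x = 0}" by auto
      then obtain u where u: "u \<in> {0..<1}" "x = gam i u \<or> x = - gam i u"
        using zero_set[OF I(1)] by auto
      from u(2) show "x \<in> H"
      proof
        assume "x = gam i u"
        then have "u \<in> {?t..1}" using x sd[OF u(1)] u(1) by (auto split: if_splits)
        then show ?thesis using \<open>x = gam i u\<close> by (auto simp: H_def)
      next
        assume "x = - gam i u"
        then have "u \<in> {0..?t}" using x sd[OF u(1)] gm[OF u(1)] u(1) by (auto split: if_splits)
        then show ?thesis using \<open>x = - gam i u\<close> by (auto simp: H_def)
      qed
    qed
    have 1: "gam i u \<in> {x \<in> S2. sg i x = 0 \<and> sg j x \<noteq> - d}" if "?t \<le> u" "u < 1" for u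
      using that t S[of u] sd[of u] gam_zero[OF I(1), of u] d by auto
    have 2: "- gam i u \<in> {x \<in> S2. sg i x = 0 \<and> sg j x \<noteq> - d}" if "0 \<le> u" "u \<le> ?t" for u
      using that t S[of u] sd[of u] gam_zero[OF I(1), of u] gm[of u] sg_minus[OF I(1) S[of u]] d by auto
    show "H \<subseteq> {x \<in> S2. sg i x = 0 \<and> sg j x \<noteq> - d}"
    proof
      fix x assume "x \<in> H"
      then consider u where "?t \<le> u" "u < 1" "x = gam i u" | "x = gam i 1"
        | u where "0 \<le> u" "u \<le> ?t" "x = - gam i u"
        unfolding H_def by force
      then show "x \<in> {x \<in> S2. sg i x = 0 \<and> sg j x \<noteq> - d}"
        using 1 2 2[of 0] t g1 by cases auto
    qed
  qed
  have HZ': "{x \<in> S2. sg i x = 0 \<and> sg j x \<noteq> d} = uminus ` H"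
  proof -
    have "x \<in> uminus ` H \<longleftrightarrow> - x \<in> H" for x by force
    then show ?thesis unfolding HZ[symmetric] using sg_minus I by auto
  qed
  have "connected (uminus ` H)" using cH by (intro connected_continuous_image continuous_intros)
  then show ?thesis using cH HZ HZ' d e by auto
qed

text \<open>The lune is the complement of \<open>A\<close> and \<open>B\<close>, so Janiszewski's
  theorem needs \<open>A \<inter> B\<close>, the closed antipodal lune, to be connected. Arguing
  with its interior \<open>L\<close> would be circular, since that is a lune again. Instead the
  boundary \<open>D\<close> is connected, two half curves sharing corners, and a part of a
  separation that avoids \<open>D\<close> lies in \<open>L\<close>; it is then open and closed in
  the sphere, hence all of it, although it misses the corner \<open>p\<close>.\<close>

lemma lune_connected:
  assumes I: "i \<in> I" "j \<in> I" "i \<noteq> j" and e: "e \<in> {-1, 1}" "e' \<in> {-1, 1}"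
  shows "connected {x \<in> S2. sg i x = e \<and> sg j x = e'}"
proof -
  define A where "A = {x \<in> S2. sg i x \<noteq> e}"
  define B where "B = {x \<in> S2. sg j x \<noteq> e'}"
  define L where "L = {x \<in> S2. sg i x = - e} \<inter> {x \<in> S2. sg j x = - e'}"
  define D where "D = {x \<in> S2. sg i x = 0 \<and> sg j x \<noteq> e'} \<union> {x \<in> S2. sg j x = 0 \<and> sg i x \<noteq> e}"
  have cl: "closed A" "closed B" unfolding A_def B_def using sides_closed I e by auto
  have v: "sg i x = - e" if "x \<in> S2" "sg i x \<noteq> e" "sg i x \<noteq> 0" for x
    using sg_values[OF I(1) that(1)] e that by auto
  have v': "sg j x = - e'" if "x \<in> S2" "sg j x \<noteq> e'" "sg j x \<noteq> 0" for x
    using sg_values[OF I(2) that(1)] e that by auto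
  have AB: "A \<inter> B = L \<union> D" "L \<inter> D = {}"
    unfolding A_def B_def L_def D_def using v v' e by auto
  have oL: "openin (top_of_set S2) L"
    unfolding L_def by (intro openin_Int sg_open) (use I e in auto)
  obtain p where p: "p \<in> S2" "{x \<in> S2. sg i x = 0 \<and> sg j x = 0} = {p, - p}"
    using meet[OF I] by auto
  then have p0: "sg i p = 0" "sg j p = 0" by blast+
  have cD: "connected D"
    unfolding D_def using half_curve_connected I e p p0 by (intro connected_Un) auto
  have pD: "p \<in> D" "p \<notin> L" using p p0 e by (auto simp: D_def L_def)
  have "connected (A \<inter> B)"
  proof (rule ccontr)
    assume "\<not> connected (A \<inter> B)"
    then obtain P Q where PQ: "closed P" "closed Q" "P \<inter> Q = {}" "P \<union> Q = A \<inter> B" "P \<noteq> {}" "Q \<noteq> {}"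
      using connected_closed_set[of "A \<inter> B"] cl by (auto simp: closed_Int)
    have *: False if "closed P" "closed Q" "P \<inter> Q = {}" "P \<union> Q = A \<inter> B" "Q \<noteq> {}" "D \<subseteq> P" for P Q
    proof -
      have Q: "Q = L - P" using that AB by auto
      have "openin (top_of_set S2) (L \<inter> - P)" using oL that(1) by (metis openin_Int_open open_Compl)
      then have "openin (top_of_set S2) Q" using Q by (simp add: Diff_eq)
      moreover have "Q \<subseteq> S2" using Q by (auto simp: L_def)
      then have "closedin (top_of_set S2) Q" using that(2) by (simp add: closed_subset)
      ultimately have "Q = S2" using connected_S2 that(5) by (auto simp: connected_clopen)
      then show False using Q pD(2) p(1) by auto
    qed
    have "D \<subseteq> P \<or> D \<subseteq> Q"
    proof -
      have "D \<subseteq> P \<union> Q" using PQ AB by auto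
      moreover have "P \<inter> Q \<inter> D = {}" using PQ by auto
      ultimately have "P \<inter> D = {} \<or> Q \<inter> D = {}" using cD PQ(1,2) by (meson connected_closedD)
      then show ?thesis using \<open>D \<subseteq> P \<union> Q\<close> by auto
    qed
    then show False using *[of P Q] *[of Q P] PQ by (auto simp: Un_commute Int_commute)
  qed
  moreover have "connected (S2 - A)" "connected (S2 - B)"
  proof -
    have "S2 - A = {x \<in> S2. sg i x = e}" "S2 - B = {x \<in> S2. sg j x = e'}" by (auto simp: A_def B_def)
    then show "connected (S2 - A)" "connected (S2 - B)" using side_connected I e by auto
  qed
  ultimately have "connected (S2 - (A \<union> B))"
    using cl by (intro Janiszewski_S2) (auto simp: A_def B_def)
  moreover have "S2 - (A \<union> B) = {x \<in> S2. sg i x = e \<and> sg j x = e'}" by (auto simp: A_def B_def)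
  ultimately show ?thesis by simp
qed

section \<open>Bounding the number of cells from below\<close>

abbreviation sign_vector :: "'a set \<Rightarrow> real ^ 3 \<Rightarrow> 'a \<Rightarrow> int" where
  "sign_vector A x \<equiv> restrict (\<lambda>i. sg i x) A"

text \<open>Cells, under their name from oriented matroid theory. Components with equal signs would
  be counted once, which a lower bound tolerates.\<close>

definition topes :: "'a set \<Rightarrow> ('a \<Rightarrow> int) set" where
  "topes A = sign_vector A ` {x \<in> S2. \<forall>i\<in>A. sg i x \<noteq> 0}"

text \<open>The pieces into which \<open>A\<close> cuts the curve \<open>l\<close>. The sign of
  \<open>l\<close> is left out, so an edge is at the same time the tope of \<open>A\<close> through
  which \<open>l\<close> passes there.\<close>

definition edges :: "'a \<Rightarrow> 'a set \<Rightarrow> ('a \<Rightarrow> int) set" where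
  "edges l A = sign_vector A ` {x \<in> S2. sg l x = 0 \<and> (\<forall>i\<in>A. sg i x \<noteq> 0)}"

definition vertices_on :: "'a \<Rightarrow> 'a set \<Rightarrow> (real ^ 3) set" where
  "vertices_on l A = {v \<in> S2. sg l v = 0 \<and> (\<exists>i\<in>A. sg i v = 0)}"

lemma finite_topes: "A \<subseteq> I \<Longrightarrow> finite (topes A)"
proof -
  assume A: "A \<subseteq> I"
  have "topes A \<subseteq> PiE A (\<lambda>_. {-1, 0, 1})"
    using sg_values A unfolding topes_def by (force simp: PiE_def Pi_def extensional_def)
  then show ?thesis using finite_PiE finite_subset A finite_I
    by (metis (no_types, lifting) finite.emptyI finite_insert)
qed

lemma edges_subset_topes: "edges l A \<subseteq> topes A"
  by (auto simp: edges_def topes_def)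

text \<open>Finitely many points cut a closed curve into equally many arcs. With \<open>T\<close>
  the set of crossing times, both numbers are twice \<open>card T\<close>, once for
  \<open>gam l\<close> and once for its antipode. The real content is that different arcs have
  different sign vectors.\<close>

lemma edges_vertices:
  assumes l: "l \<in> I" "l \<notin> A" and A: "A \<subseteq> I" "A \<noteq> {}"
  shows "card (edges l A) = card (vertices_on l A)" "finite (vertices_on l A)"
proof -
  let ?c = "crossing_time l"
  define T where "T = ?c ` A"
  have fA: "finite A" using A finite_I finite_subset by blast
  then have fT: "finite T" by (simp add: T_def)
  have "\<forall>j\<in>A. \<exists>d\<in>{-1, 1}. \<forall>t\<in>{0..<1}. sg j (gam l t) =
    (if t = ?c j then 0 else if t < ?c j then - d else d)"
    using signs_along_curve l A by blast
  then obtain d where d: "\<And>j. j \<in> A \<Longrightarrow> d j \<in> {-1, 1}"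
    and sgd: "\<And>j t. \<lbrakk>j \<in> A; t \<in> {0..<1}\<rbrakk> \<Longrightarrow> sg j (gam l t) =
        (if t = ?c j then 0 else if t < ?c j then - d j else d j)"
    by metis
  have c: "?c j \<in> {0..<1}" if "j \<in> A" for j using crossing_time(1) that l A by blast
  then have T01: "T \<subseteq> {0..<1}" by (auto simp: T_def)
  have S: "gam l t \<in> S2" if "t \<in> {0..<1}" for t using gam_S2 l that by auto
  have z: "sg l (gam l t) = 0" if "t \<in> {0..<1}" for t using gam_zero l that by auto
  have gm: "sg i (- gam l t) = - sg i (gam l t)" if "i \<in> I" "t \<in> {0..<1}" for i t
    using sg_minus S that by auto
  have V: "vertices_on l A = gam l ` T \<union> (\<lambda>t. - gam l t) ` T" (is "?L = ?R")
  proof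
    show "?L \<subseteq> ?R"
    proof
      fix v assume v: "v \<in> ?L"
      then have "v \<in> {x \<in> S2. sg l x = 0}" by (auto simp: vertices_on_def)
      then obtain t where t: "t \<in> {0..<1}" "v = gam l t \<or> v = - gam l t"
        using zero_set[OF l(1)] by auto
      obtain j where j: "j \<in> A" "sg j v = 0" using v by (auto simp: vertices_on_def)
      have "sg j (gam l t) = 0" using t j gm[of j t] A(1) by auto
      then have "t = ?c j" using sgd[OF j(1) t(1)] d[OF j(1)] by (auto split: if_splits)
      then have "t \<in> T" using j by (auto simp: T_def)
      then show "v \<in> ?R" using t by auto
    qed
    show "?R \<subseteq> ?L"
    proof -
      have "gam l t \<in> ?L \<and> - gam l t \<in> ?L" if tT: "t \<in> T" for t
      proof -
        obtain j where j: "j \<in> A" "t = ?c j" using tT T_def by auto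
        have t: "t \<in> {0..<1}" using T01 tT by auto
        have "sg j (gam l t) = 0" using sgd[OF j(1) t] j by simp
        then show ?thesis using z[OF t] S[OF t] gm[of j t] gm[of l t] t j l A
          unfolding vertices_on_def by auto
      qed
      then show ?thesis by auto
    qed
  qed
  have inj1: "inj_on (gam l) T" "inj_on (\<lambda>t. - gam l t) T"
    using gam_inj[OF l(1)] T01 by (auto simp: inj_on_def subset_iff)
  have disj1: "gam l ` T \<inter> (\<lambda>t. - gam l t) ` T = {}"
  proof (rule ccontr)
    assume "gam l ` T \<inter> (\<lambda>t. - gam l t) ` T \<noteq> {}"
    then obtain s t where st: "s \<in> T" "t \<in> T" "gam l s = - gam l t" by auto
    then have "s = t" using gam_inj[OF l(1)] T01 by blast
    then have "gam l t = 0" using st by (simp add: eq_neg_iff_add_eq_0 flip: scaleR_2)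
    then show False using gam_nz[OF l(1), of t] st T01 by auto
  qed
  show fin: "finite (vertices_on l A)" using V fT by auto
  have cV: "card (vertices_on l A) = 2 * card T"
    unfolding V using inj1 disj1 fT by (simp add: card_Un_disjoint card_image)
  text \<open>\<open>E t\<close> is the sign vector just after the parameter \<open>t\<close>.\<close>
  define E where "E t = restrict (\<lambda>j. if ?c j \<le> t then d j else - d j) A" for t
  define E' where "E' t = restrict (\<lambda>j. if ?c j \<le> t then - d j else d j) A" for t
  have Esg: "sign_vector A (gam l t) = E u" "sign_vector A (- gam l t) = E' u"
    if t: "t \<in> {0..<1}" and u: "\<And>j. j \<in> A \<Longrightarrow> t \<noteq> ?c j \<and> (?c j \<le> u \<longleftrightarrow> ?c j < t)" for t u
    using u sgd[OF _ t] gm[OF _ t] A(1) unfolding E_def E'_def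
    by (force intro!: restrict_ext split: if_splits)+
  have Ed: "edges l A = E ` T \<union> E' ` T" (is "_ = ?R")
  proof
    show "edges l A \<subseteq> ?R"
    proof
      fix e assume "e \<in> edges l A"
      then obtain x where x: "x \<in> S2" "sg l x = 0" "\<And>i. i \<in> A \<Longrightarrow> sg i x \<noteq> 0" "e = sign_vector A x"
        by (auto simp: edges_def)
      then have "x \<in> {x \<in> S2. sg l x = 0}" by auto
      then obtain t where t: "t \<in> {0..<1}" "x = gam l t \<or> x = - gam l t"
        using zero_set[OF l(1)] by auto
      have nt: "t \<noteq> ?c j" if "j \<in> A" for j
        using x(3)[OF that] t sgd[OF that t(1)] gm[of j t] A that by auto
      show "e \<in> ?R"
      proof (cases "\<exists>u\<in>T. u < t")
        case True
        define u where "u = Max {u \<in> T. u < t}"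
        have ne: "finite {u \<in> T. u < t}" "{u \<in> T. u < t} \<noteq> {}" using True fT by auto
        have u: "u \<in> T" "u < t" using Max_in[OF ne] by (auto simp: u_def)
        have *: "t \<noteq> ?c j \<and> (?c j \<le> u \<longleftrightarrow> ?c j < t)" if "j \<in> A" for j
        proof -
          have "?c j \<le> u" if "?c j < t"
            using Max_ge[OF ne(1), of "?c j"] that \<open>j \<in> A\<close> by (auto simp: u_def T_def)
          then show ?thesis using nt that u by auto
        qed
        have "e = E u \<or> e = E' u" using Esg[OF t(1) *] t(2) x(4) by auto
        then show ?thesis using u by auto
      next
        case False
        \<comment> \<open>Before the first crossing the arc of \<open>gam l\<close> continues,
          backwards through the parameter 0, the arc of the antipodal path after its last crossing.
          So it is recorded under the last time, with the roles of \<open>E\<close> and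
          \<open>E'\<close> exchanged.\<close>
        define u where "u = Max T"
        have u: "u \<in> T" "\<And>j. j \<in> A \<Longrightarrow> ?c j \<le> u" unfolding u_def using fT A(2) by (auto simp: T_def)
        have *: "t < ?c j" if "j \<in> A" for j using False nt[OF that] that by (force simp: T_def)
        have "sign_vector A (gam l t) = E' u" "sign_vector A (- gam l t) = E u"
          using u * sgd[OF _ t(1)] gm[OF _ t(1)] A(1) unfolding E_def E'_def
          by (force intro!: restrict_ext split: if_splits)+
        then show ?thesis using u t(2) x(4) by auto
      qed
    qed
    have "E u \<in> edges l A \<and> E' u \<in> edges l A" if u: "u \<in> T" for u
    proof -
      \<comment> \<open>The next crossing time after \<open>u\<close>, or the end 1 of the parameter
        range; the midpoint \<open>t\<close> below lies on the arc that starts at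
        \<open>u\<close>.\<close>
      define w where "w = Min (insert 1 {v \<in> T. u < v})"
      have fin: "finite (insert 1 {v \<in> T. u < v})" using fT by simp
      have "w \<in> insert 1 {v \<in> T. u < v}" unfolding w_def by (rule Min_in[OF fin]) simp
      then have uw: "u < w" using T01 u by auto
      have w1: "w \<le> 1" and wv: "\<And>v. v \<in> T \<Longrightarrow> u < v \<Longrightarrow> w \<le> v"
        unfolding w_def by (auto intro!: Min_le simp: fT)
      define t where "t = (u + w) / 2"
      have t: "u < t" "t < w" "t \<in> {0..<1}" using uw w1 u T01 by (auto simp: t_def)
      have *: "t \<noteq> ?c j \<and> (?c j \<le> u \<longleftrightarrow> ?c j < t)" if "j \<in> A" for j
        using wv[of "?c j"] that t by (force simp: T_def)
      have nz: "sg j (gam l t) \<noteq> 0" if "j \<in> A" for j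
        using *[OF that] sgd[OF that t(3)] d[OF that] by auto
      then have "sign_vector A (gam l t) \<in> edges l A" "sign_vector A (- gam l t) \<in> edges l A"
        unfolding edges_def using S[OF t(3)] z[OF t(3)] gm[OF _ t(3)] l A
        by (auto intro!: imageI)
      then show ?thesis using Esg[OF t(3) *] by simp
    qed
    then show "?R \<subseteq> edges l A" by auto
  qed
  \<comment> \<open>The entry of a curve crossed at time \<open>s\<close> shows whether
    \<open>t\<close> has reached \<open>s\<close>, and conversely.\<close>
  have EE: "E s = E t \<Longrightarrow> s = t" "E' s = E' t \<Longrightarrow> s = t" if st: "s \<in> T" "t \<in> T" for s t
  proof -
    obtain i j where ij: "i \<in> A" "j \<in> A" "s = ?c i" "t = ?c j" using st by (auto simp: T_def)
    have nz: "d i \<noteq> 0" "d j \<noteq> 0" using d ij by fastforce+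
    have E: "E s i = d i" "E t i = (if s \<le> t then d i else - d i)"
        "E t j = d j" "E s j = (if t \<le> s then d j else - d j)"
      and E': "E' s i = - d i" "E' t i = (if s \<le> t then - d i else d i)"
        "E' t j = - d j" "E' s j = (if t \<le> s then - d j else d j)"
      using ij by (simp_all add: E_def E'_def)
    show "s = t" if "E s = E t"
    proof (rule antisym)
      show "s \<le> t" using E(1,2) nz(1) unfolding that by (cases "s \<le> t") auto
      show "t \<le> s" using E(3,4) nz(2) unfolding that by (cases "t \<le> s") auto
    qed
    show "s = t" if "E' s = E' t"
    proof (rule antisym)
      show "s \<le> t" using E'(1,2) nz(1) unfolding that by (cases "s \<le> t") auto
      show "t \<le> s" using E'(3,4) nz(2) unfolding that by (cases "t \<le> s") auto
    qed
  qed
  have "E s \<noteq> E' t" if "s \<in> T" "t \<in> T" for s t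
  proof -
    \<comment> \<open>A curve crossed first of all has been passed at every time in
      \<open>T\<close>, so its entry separates the two halves.\<close>
    have "Min T \<in> T" using Min_in[OF fT] A(2) by (auto simp: T_def)
    then obtain j where j: "j \<in> A" "?c j = Min T" unfolding T_def by (metis imageE)
    then have "?c j \<le> s" "?c j \<le> t" using that fT by auto
    then have "E s j = d j" "E' t j = - d j" using j by (simp_all add: E_def E'_def)
    then show ?thesis using d[OF j(1)] by auto
  qed
  then have disj: "E ` T \<inter> E' ` T = {}" by auto
  have "inj_on E T" "inj_on E' T" using EE by (auto simp: inj_on_def)
  then have "card (edges l A) = 2 * card T"
    unfolding Ed using disj fT by (simp add: card_Un_disjoint card_image)
  then show "card (edges l A) = card (vertices_on l A)" using cV by simp
qed

lemma region_open:
  assumes "finite A" "A \<subseteq> I" "\<forall>i\<in>A. f i \<noteq> 0"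
  shows "openin (top_of_set S2) {x \<in> S2. \<forall>i\<in>A. sg i x = f i}"
  using assms
proof (induction A)
  case (insert i A)
  have "{x \<in> S2. \<forall>i\<in>insert i A. sg i x = f i} =
      {x \<in> S2. sg i x = f i} \<inter> {x \<in> S2. \<forall>i\<in>A. sg i x = f i}" by auto
  moreover have "openin (top_of_set S2) {x \<in> S2. sg i x = f i}" using insert sg_open by auto
  moreover have "openin (top_of_set S2) {x \<in> S2. \<forall>i\<in>A. sg i x = f i}" using insert by auto
  ultimately show ?case by (simp only: openin_Int)
qed (simp add: openin_subtopology_refl)

text \<open>The signs of \<open>A\<close> persist on an open neighbourhood of \<open>x\<close>, and
  both sides of \<open>l\<close> reach into it.\<close>

lemma sg_dense_region:
  assumes "l \<in> I" "A \<subseteq> I" "x \<in> S2" "sg l x = 0" "\<forall>i\<in>A. sg i x \<noteq> 0" "s \<in> {-1, 1}"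
  shows "\<exists>y\<in>S2. sg l y = s \<and> (\<forall>i\<in>A. sg i y = sg i x)"
proof -
  have "finite A" using assms finite_I finite_subset by blast
  then have "openin (top_of_set S2) {y \<in> S2. \<forall>i\<in>A. sg i y = sg i x}"
    using region_open assms by auto
  from sg_dense[OF assms(1,3,4) this _ assms(6)] show ?thesis using assms(3) by auto
qed

text \<open>\<open>X s\<close> consists of the old cells with a part on side \<open>s\<close> of
  \<open>l\<close>. Every old cell is in \<open>X 1\<close> or \<open>X (-1)\<close>, and those that
  carry an edge of \<open>l\<close> are in both. Hence the new cells number at least the size of the
  union plus that of the intersection, and the edges are as many as the vertices on
  \<open>l\<close>.\<close>

lemma topes_insert:
  assumes l: "l \<in> I" "l \<notin> A" and A: "A \<subseteq> I" "A \<noteq> {}"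
  shows "card (topes A) + card (vertices_on l A) \<le> card (topes (insert l A))"
proof -
  let ?B = "insert l A"
  define X where "X s = {T \<in> topes A. T(l := s) \<in> topes ?B}" for s
  have fin: "finite (topes A)" "finite (topes ?B)" using finite_topes l A by auto
  have fX: "finite (X s)" for s using fin by (auto simp: X_def)
  have ext: "(sign_vector A x)(l := s) \<in> topes ?B"
    if x: "x \<in> S2" "sg l x = 0" "\<forall>i\<in>A. sg i x \<noteq> 0" "s \<in> {-1, 1}" for x s
  proof -
    obtain y where y: "y \<in> S2" "sg l y = s" "\<forall>i\<in>A. sg i y = sg i x"
      using sg_dense_region[OF l(1) A(1) x] by auto
    have "(sign_vector A x)(l := s) = sign_vector ?B y" using y l by (auto simp: fun_eq_iff)
    moreover have "sign_vector ?B y \<in> topes ?B" unfolding topes_def using y x by auto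
    ultimately show ?thesis by simp
  qed
  have "edges l A \<subseteq> X 1 \<inter> X (-1)"
    using ext edges_subset_topes[of l A] unfolding X_def edges_def by blast
  then have 1: "card (vertices_on l A) \<le> card (X 1 \<inter> X (-1))"
    using edges_vertices[OF l A] card_mono fX by (metis finite_Int)
  have "topes A \<subseteq> X 1 \<union> X (-1)"
  proof
    fix T assume T: "T \<in> topes A"
    then obtain x where x: "x \<in> S2" "\<forall>i\<in>A. sg i x \<noteq> 0" "T = sign_vector A x"
      by (auto simp: topes_def)
    show "T \<in> X 1 \<union> X (-1)"
    proof (cases "sg l x = 0")
      case True
      then show ?thesis using ext x T by (auto simp: X_def)
    next
      case False
      have "T(l := sg l x) = sign_vector ?B x" using x l by (auto simp: fun_eq_iff)
      moreover have "sign_vector ?B x \<in> topes ?B" unfolding topes_def using x False by auto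
      ultimately have "T \<in> X (sg l x)" using T by (simp add: X_def)
      then show ?thesis using sg_values[OF l(1) x(1)] False by auto
    qed
  qed
  then have 2: "card (topes A) \<le> card (X 1 \<union> X (-1))"
    using card_mono fX by (metis finite_Un)
  have Tl: "T l = undefined" if "T \<in> topes A" for T using that l by (auto simp: topes_def)
  have inj: "inj_on (\<lambda>T. T(l := s)) (X s)" for s
  proof (rule inj_onI)
    fix T T' assume "T \<in> X s" "T' \<in> X s" and *: "T(l := s) = T'(l := s)"
    then have "T l = T' l" using Tl[of T] Tl[of T'] by (simp add: X_def)
    with * show "T = T'" by (metis fun_upd_triv fun_upd_upd)
  qed
  have "card (X 1) + card (X (-1)) = card ((\<lambda>T. T(l := 1)) ` X 1 \<union> (\<lambda>T. T(l := -1)) ` X (-1))"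
  proof (subst card_Un_disjoint)
    show "(\<lambda>T. T(l := 1)) ` X 1 \<inter> (\<lambda>T. T(l := -1)) ` X (-1) = {}"
      by (auto simp: fun_eq_iff split: if_splits)
  qed (simp_all add: fX card_image inj)
  also have "\<dots> \<le> card (topes ?B)"
    by (rule card_mono) (auto simp: fin X_def)
  finally show ?thesis using 1 2 card_Un_Int[OF fX fX, of 1 "-1"] by linarith
qed

definition degree :: "'a set \<Rightarrow> real ^ 3 \<Rightarrow> nat" where
  "degree A v = card {i \<in> A. sg i v = 0}"

definition vertices :: "(real ^ 3) set" where
  "vertices = {v \<in> S2. 2 \<le> degree I v}"

lemma vertices_eq: "vertices = (\<Union>l\<in>I. vertices_on l (I - {l}))"
proof -
  have "2 \<le> degree I v \<longleftrightarrow> (\<exists>i\<in>I. sg i v = 0 \<and> (\<exists>j\<in>I - {i}. sg j v = 0))" for v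
    unfolding degree_def using card_le_Suc0_iff_eq[of "{i \<in> I. sg i v = 0}"] finite_I
    by (auto simp: not_less_eq_eq[symmetric] numeral_2_eq_2)
  then show ?thesis by (auto simp: vertices_def vertices_on_def)
qed

lemma finite_vertices: "finite vertices"
proof (cases "\<exists>i. I \<subseteq> {i}")
  case True
  then have "degree I v \<le> 1" for v
    unfolding degree_def by (metis (no_types, lifting) card.empty card_mono finite.emptyI
        finite_insert is_singletonI is_singleton_altdef mem_Collect_eq subsetD subsetI)
  then have "vertices = {}" unfolding vertices_def by (metis (lifting) Collect_empty_eq not_less_eq_eq numeral_2_eq_2 One_nat_def)
  then show ?thesis by simp
next
  case False
  have "finite (vertices_on l (I - {l}))" if "l \<in> I" for l
    using edges_vertices(2)[of l "I - {l}"] that False by blast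
  then show ?thesis unfolding vertices_eq using finite_I by auto
qed

lemma vertices_on_subset: "l \<in> I \<Longrightarrow> A \<subseteq> I - {l} \<Longrightarrow> vertices_on l A \<subseteq> vertices"
  unfolding vertices_eq vertices_on_def by fastforce

text \<open>The sum ranges over the vertices of the whole arrangement; truncated subtraction makes
  those with fewer than two curves of \<open>A\<close> contribute 0. Inserting \<open>l\<close>
  raises a summand by one exactly at the points of \<open>vertices_on l A\<close>, which is the gain
  in \<open>topes_insert\<close>. The initial 2 counts the sides of a single curve.\<close>

lemma topes_lower_bound:
  assumes "finite A" "A \<noteq> {}" "A \<subseteq> I"
  shows "2 + (\<Sum>v\<in>vertices. degree A v - 1) \<le> card (topes A)"
  using assms
proof (induction A rule: finite_ne_induct)
  case (singleton i)
  have "degree {i} v - 1 = 0" for v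
    unfolding degree_def using card_mono[of "{i}" "{j \<in> {i}. sg j v = 0}"] by auto
  moreover have "2 \<le> card (topes {i})"
  proof -
    have i: "i \<in> I" using singleton by simp
    have 0: "gam i 0 \<in> S2" "sg i (gam i 0) = 0" using i gam_S2 gam_zero by auto
    have "(\<lambda>s. restrict (\<lambda>_. s) {i}) ` {-1, 1} \<subseteq> topes {i}"
    proof
      fix T assume "T \<in> (\<lambda>s. restrict (\<lambda>_. s) {i}) ` {-1, 1 :: int}"
      then obtain s where s: "s \<in> {-1, 1}" "T = restrict (\<lambda>_. s) {i}" by auto
      obtain y where "y \<in> S2" "sg i y = s" using sg_dense_region[OF i, of "{}" _ s] 0 s by auto
      moreover then have "T = sign_vector {i} y" using s by (auto simp: fun_eq_iff)
      ultimately show "T \<in> topes {i}" unfolding topes_def using s by auto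
    qed
    moreover have "inj_on (\<lambda>s::int. restrict (\<lambda>_. s) {i}) {-1, 1}"
      by (auto simp: inj_on_def dest: fun_cong[of _ _ i])
    ultimately have "card {-1, 1 :: int} \<le> card (topes {i})"
      using card_inj_on_le finite_topes[of "{i}"] i by (metis empty_subsetI insert_subset)
    then show ?thesis by simp
  qed
  ultimately show ?case by simp
next
  case (insert l A)
  have deg: "degree (insert l A) v - 1 = degree A v - 1 + (if v \<in> vertices_on l A then 1 else 0)"
    if "v \<in> vertices" for v
  proof -
    have f: "finite {i \<in> A. sg i v = 0}" using insert by simp
    show ?thesis
    proof (cases "sg l v = 0")
      case True
      have "{i \<in> insert l A. sg i v = 0} = insert l {i \<in> A. sg i v = 0}" using True by auto
      then have "degree (insert l A) v = Suc (degree A v)"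
        unfolding degree_def using f insert by simp
      moreover have "v \<in> vertices_on l A \<longleftrightarrow> degree A v \<noteq> 0"
        using True that f unfolding vertices_on_def degree_def vertices_def by auto
      ultimately show ?thesis by auto
    next
      case False
      then have "{i \<in> insert l A. sg i v = 0} = {i \<in> A. sg i v = 0}" by auto
      then show ?thesis using False by (simp add: degree_def vertices_on_def)
    qed
  qed
  have sub: "vertices_on l A \<subseteq> vertices" using vertices_on_subset insert by auto
  have "(\<Sum>v\<in>vertices. degree (insert l A) v - 1) =
      (\<Sum>v\<in>vertices. degree A v - 1) + (\<Sum>v\<in>vertices. if v \<in> vertices_on l A then 1 else 0)"
    using deg by (simp add: sum.distrib)
  also have "(\<Sum>v\<in>vertices. if v \<in> vertices_on l A then 1 else 0) = card (vertices_on l A)"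
    using sub finite_vertices by (simp add: Int_absorb1 flip: sum.inter_restrict)
  finally show ?case using topes_insert[of l A] insert by auto
qed

section \<open>Walls of cells\<close>

text \<open>Having no common point with \<open>a\<close> and \<open>b\<close> together,
  \<open>c\<close> crosses them at different times. The product of the two signs is invariant under
  the antipodal map; it takes one value between these times and the other after both. So every pair
  of signs occurs on \<open>c\<close> or on its antipode, along a whole interval, which leaves room
  to avoid \<open>V\<close>.\<close>

lemma curve_meets_lune:
  assumes I: "a \<in> I" "b \<in> I" "c \<in> I" "a \<noteq> b" "c \<noteq> a" "c \<noteq> b"
    and nc: "\<And>x. x \<in> S2 \<Longrightarrow> sg c x = 0 \<Longrightarrow> sg a x = 0 \<Longrightarrow> sg b x \<noteq> 0"
    and e: "e \<in> {-1, 1}" "e' \<in> {-1, 1}" and V: "finite V"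
  shows "\<exists>y\<in>S2 - V. sg c y = 0 \<and> sg a y = e \<and> sg b y = e'"
proof -
  let ?t = "crossing_time c"
  have t: "?t a \<in> {0..<1}" "?t b \<in> {0..<1}" using crossing_time(1) I by blast+
  have "?t a \<noteq> ?t b"
    using nc[of "gam c (?t a)"] crossing_time(2)[of c] gam_S2[of c "?t a"] gam_zero[of c "?t a"] I t by auto
  obtain d where d: "d \<in> {-1, 1}" "\<forall>t\<in>{0..<1}. sg a (gam c t) =
    (if t = ?t a then 0 else if t < ?t a then - d else d)"
    using signs_along_curve[of c a] I by auto
  obtain d' where d': "d' \<in> {-1, 1}" "\<forall>t\<in>{0..<1}. sg b (gam c t) =
    (if t = ?t b then 0 else if t < ?t b then - d' else d')"
    using signs_along_curve[of c b] I by auto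
  have *: "\<exists>y\<in>S2 - V. sg c y = 0 \<and> sg a y = e \<and> sg b y = e'"
    if uw: "u < w" "0 \<le> u" "w \<le> 1"
      and K: "\<And>t. u < t \<Longrightarrow> t < w \<Longrightarrow> \<exists>s\<in>{-1, 1}. sg a (gam c t) = s * e \<and> sg b (gam c t) = s * e'" for u w
  proof -
    have "inj_on (gam c) {u<..<w}"
      using gam_inj[OF I(3)] uw by (auto simp: inj_on_def)
    then have "infinite (gam c ` {u<..<w})"
      using uw finite_imageD infinite_Ioo by blast
    then obtain t where t: "t \<in> {u<..<w}" "gam c t \<notin> V \<union> uminus ` V"
      using finite_subset[of "gam c ` {u<..<w}" "V \<union> uminus ` V"] V by blast
    then have S: "gam c t \<in> S2" "sg c (gam c t) = 0"
      using gam_S2[OF I(3)] gam_zero[OF I(3)] uw by auto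
    have nV: "gam c t \<notin> V" "- gam c t \<notin> V" using t(2) by force+
    obtain s where s: "s \<in> {-1, 1}" "sg a (gam c t) = s * e" "sg b (gam c t) = s * e'"
      using K[of t] t(1) by fastforce
    show ?thesis
    proof (cases "s = 1")
      case True
      then show ?thesis using S nV s by auto
    next
      case False
      then show ?thesis using S nV s sg_minus[OF _ S(1)] I by (intro bexI[of _ "- gam c t"]) auto
    qed
  qed
  show ?thesis
  proof (cases "d * d' = e * e'")
    case True
    show ?thesis
    proof (rule *[of "max (?t a) (?t b)" 1])
      fix t assume "max (?t a) (?t b) < t" "t < 1"
      then show "\<exists>s\<in>{-1, 1}. sg a (gam c t) = s * e \<and> sg b (gam c t) = s * e'"
        using d d' t e True by auto
    qed (use t in auto)
  next
    case False
    show ?thesis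
    proof (rule *[of "min (?t a) (?t b)" "max (?t a) (?t b)"])
      fix t assume "min (?t a) (?t b) < t" "t < max (?t a) (?t b)"
      then show "\<exists>s\<in>{-1, 1}. sg a (gam c t) = s * e \<and> sg b (gam c t) = s * e'"
        using d d' t e False by (auto simp: min_def max_def split: if_splits)
    qed (use t \<open>?t a \<noteq> ?t b\<close> in auto)
  qed
qed

text \<open>The curves contributing a facet to the cell: when its own sign is forgotten, the vector
  becomes that of an edge. Adjacency is thereby a matter of signs, not of closures of
  components.\<close>

definition walls :: "('a \<Rightarrow> int) \<Rightarrow> 'a set" where
  "walls T = {i \<in> I. restrict T (I - {i}) \<in> edges i (I - {i})}"

text \<open>The cell \<open>R\<close> and the set \<open>Q\<close> of points with some sign opposite
  to that of \<open>x\<close> are disjoint and open. Once the finitely many vertices are removed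
  they cover the lune \<open>L\<close>, which remains connected, so it lies in \<open>R\<close>. A
  curve \<open>c\<close> missing the corner \<open>p\<close> would however pass through the
  lune.\<close>

lemma walls_superset:
  assumes ab: "a \<in> I" "b \<in> I" "a \<noteq> b" and T: "T \<in> topes I" and W: "walls T \<subseteq> {a, b}"
  shows "\<exists>p\<in>S2. \<forall>i\<in>I. sg i p = 0"
proof (rule ccontr)
  assume nc: "\<not> ?thesis"
  obtain p where p: "p \<in> S2" "{x \<in> S2. sg a x = 0 \<and> sg b x = 0} = {p, - p}"
    using meet[OF ab] by auto
  obtain c where c: "c \<in> I" "sg c p \<noteq> 0" using nc p by auto
  have pab: "sg a p = 0" "sg b p = 0" using p(2) by blast+
  obtain x where x: "x \<in> S2" "\<forall>i\<in>I. sg i x \<noteq> 0" "T = sign_vector I x"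
    using T by (auto simp: topes_def)
  have xv: "sg i x \<in> {-1, 1}" if "i \<in> I" for i using sg_values[OF that x(1)] x(2) that by auto
  define R where "R = {y \<in> S2. \<forall>i\<in>I. sg i y = sg i x}"
  define L where "L = {y \<in> S2. sg a y = sg a x \<and> sg b y = sg b x}"
  define Q where "Q = (\<Union>i\<in>I. {y \<in> S2. sg i y = - sg i x})"
  have oR: "openin (top_of_set S2) R" unfolding R_def by (rule region_open) (use finite_I x in auto)
  have "openin (top_of_set S2) ({y \<in> S2. sg a y = sg a x} \<inter> {y \<in> S2. sg b y = sg b x})"
    by (intro openin_Int sg_open) (use ab x in auto)
  moreover have "L = {y \<in> S2. sg a y = sg a x} \<inter> {y \<in> S2. sg b y = sg b x}" by (auto simp: L_def)
  ultimately have oL: "openin (top_of_set S2) L" by simp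
  have oQ: "openin (top_of_set S2) Q" unfolding Q_def
    by (intro openin_Union) (use x sg_open in auto)
  have "connected L" unfolding L_def by (rule lune_connected) (use ab xv in auto)
  moreover have "p \<notin> L" using pab x ab by (auto simp: L_def)
  ultimately have cL: "connected (L - vertices)"
    \<comment> \<open>The corner \<open>p\<close> shows that the lune is not the whole
      sphere.\<close>
    using connected_S2_delete_finite oL finite_vertices p(1) by blast
  have cov: "L - vertices \<subseteq> R \<union> Q"
  proof
    fix y assume y: "y \<in> L - vertices"
    then have yS: "y \<in> S2" by (auto simp: L_def)
    show "y \<in> R \<union> Q"
    proof (rule ccontr)
      assume n: "y \<notin> R \<union> Q"
      have val: "sg j y = sg j x" if "j \<in> I" "sg j y \<noteq> 0" for j
        using n that sg_values[OF that(1) yS] xv[OF that(1)] yS by (auto simp: Q_def)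
      obtain i where i: "i \<in> I" "sg i y = 0" using n val yS by (auto simp: R_def)
      \<comment> \<open>This is why vertices were removed: \<open>y\<close> lies on \<open>i\<close>
        alone, so it is a point of an edge, and \<open>i\<close> becomes a wall of
        \<open>T\<close>.\<close>
      have nz: "sg j y \<noteq> 0" if "j \<in> I - {i}" for j
        using i that y yS vertices_eq by (auto simp: vertices_on_def)
      have "restrict T (I - {i}) = sign_vector (I - {i}) y"
        using val nz unfolding x(3) by (auto simp: fun_eq_iff)
      then have "i \<in> walls T" unfolding walls_def edges_def using i nz yS by blast
      then have "i = a \<or> i = b" using W by auto
      then show False using i(2) y x(2) ab by (auto simp: L_def)
    qed
  qed
  have "R \<inter> Q = {}" using x(2) by (auto simp: R_def Q_def)
  moreover obtain O1 where "open O1" "R = S2 \<inter> O1" using oR by (auto simp: openin_open)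
  moreover obtain O2 where "open O2" "Q = S2 \<inter> O2" using oQ by (auto simp: openin_open)
  moreover have "L - vertices \<subseteq> S2" by (auto simp: L_def)
  ultimately have dis: "R \<inter> (L - vertices) = {} \<or> Q \<inter> (L - vertices) = {}"
    using connectedD[OF cL, of O1 O2] cov by blast
  have "x \<notin> vertices" using x(2) unfolding vertices_eq vertices_on_def by auto
  then have "x \<in> R \<inter> (L - vertices)" using x by (auto simp: R_def L_def)
  then have "L - vertices \<subseteq> R" using dis cov by blast
  moreover have "\<exists>y\<in>S2 - vertices. sg c y = 0 \<and> sg a y = sg a x \<and> sg b y = sg b x"
  proof (rule curve_meets_lune)
    fix z assume z: "z \<in> S2" "sg c z = 0" "sg a z = 0"
    show "sg b z \<noteq> 0"
    proof
      assume "sg b z = 0"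
      then have "z = p \<or> z = - p" using z p(2) by blast
      then show False using c z sg_minus[OF c(1) p(1)] by auto
    qed
  qed (use ab c pab xv finite_vertices in auto)
  ultimately show False using c x(2) by (auto simp: L_def R_def)
qed

lemma three_walls:
  assumes nc: "\<And>p. p \<in> S2 \<Longrightarrow> \<exists>i\<in>I. sg i p \<noteq> 0" and T: "T \<in> topes I"
  shows "3 \<le> card (walls T)"
proof (rule ccontr)
  assume "\<not> 3 \<le> card (walls T)"
  then have W: "card (walls T) \<le> 2" "walls T \<subseteq> I" by (auto simp: walls_def)
  have fW: "finite (walls T)" using W finite_I finite_subset by blast
  obtain i where i: "i \<in> I" using nc T by (force simp: topes_def)
  then obtain j where j: "j \<in> I" "j \<noteq> i"
    using nc[of "gam i 0"] gam_S2[OF i, of 0] gam_zero[OF i, of 0] by auto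
  \<comment> \<open>A lune needs two distinct curves, so a smaller set of walls is padded with other
    curves.\<close>
  have "\<exists>a\<in>I. \<exists>b\<in>I. a \<noteq> b \<and> walls T \<subseteq> {a, b}"
  proof -
    consider "card (walls T) = 0" | "card (walls T) = 1" | "card (walls T) = 2" using W by linarith
    then show ?thesis
    proof cases
      case 1
      then show ?thesis using i j fW by auto
    next
      case 2
      then obtain k where "walls T = {k}" by (auto simp: card_1_singleton_iff)
      then show ?thesis using i j W by (cases "k = i") auto
    next
      case 3
      then show ?thesis using W by (auto simp: card_2_iff)
    qed
  qed
  then show False using walls_superset T nc by meson
qed

text \<open>An edge borders at most two cells, one for each sign of its own curve: cell and wall are
  recovered from the curve, the edge and that sign.\<close>

lemma sum_card_walls: "(\<Sum>T\<in>topes I. card (walls T)) \<le> 2 * (\<Sum>i\<in>I. card (edges i (I - {i})))"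
proof -
  have fT: "finite (topes I)" by (simp add: finite_topes)
  have "(\<Sum>T\<in>topes I. card (walls T)) = card (Sigma (topes I) walls)"
    using fT finite_I by (subst card_SigmaI) (auto simp: walls_def)
  also have "\<dots> \<le> card (Sigma I (\<lambda>i. edges i (I - {i}) \<times> {-1, 1 :: int}))"
  proof (rule card_inj_on_le)
    show "finite (Sigma I (\<lambda>i. edges i (I - {i}) \<times> {-1, 1 :: int}))"
      using finite_I by (auto intro!: finite_subset[OF edges_subset_topes] finite_topes)
    have *: "T = T'" if T: "T \<in> topes I" "T' \<in> topes I"
      and r: "restrict T (I - {i}) = restrict T' (I - {i})" "T i = T' i" for T T' i
    proof
      fix j
      show "T j = T' j" for j
      proof (cases "j \<in> I - {i}")
        case True
        then show ?thesis using r(1) by (metis restrict_apply')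
      next
        case False
        then show ?thesis using r(2) T by (cases "j = i") (auto simp: topes_def)
      qed
    qed
    show "inj_on (\<lambda>(T, i). (i, restrict T (I - {i}), T i)) (Sigma (topes I) walls)"
      by (intro inj_onI) (auto intro: *)
    have **: "T i \<in> {-1, 1}" if "T \<in> topes I" "i \<in> I" for T i
      using that sg_values[OF that(2)] by (fastforce simp: topes_def)
    show "(\<lambda>(T, i). (i, restrict T (I - {i}), T i)) ` Sigma (topes I) walls
        \<subseteq> Sigma I (\<lambda>i. edges i (I - {i}) \<times> {-1, 1 :: int})"
      by (auto simp: walls_def dest: **)
  qed
  also have "\<dots> = 2 * (\<Sum>i\<in>I. card (edges i (I - {i})))"
    using finite_I by (subst card_SigmaI) (auto intro!: finite_subset[OF edges_subset_topes]
        finite_topes simp: sum_distrib_left card_cartesian_product mult_2)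
  finally show ?thesis .
qed

text \<open>Summed over all curves, the vertices are counted with their degrees, so there are sum
  deg edges. The lower bound on the cells, multiplied by 3, turns its 2 into the 6.\<close>

theorem melchior:
  assumes nc: "\<And>p. p \<in> S2 \<Longrightarrow> \<exists>i\<in>I. sg i p \<noteq> 0"
  shows "(\<Sum>v\<in>vertices. degree I v) + 6 \<le> 3 * card vertices"
proof -
  have "axis 1 1 \<in> S2" by (simp add: S2_def)
  then obtain i where i: "i \<in> I" using nc by auto
  then obtain j where j: "j \<in> I" "j \<noteq> i"
    using nc[of "gam i 0"] gam_S2[OF i, of 0] gam_zero[OF i, of 0] by auto
  have "3 * card (topes I) \<le> (\<Sum>T\<in>topes I. card (walls T))"
    using sum_mono[of "topes I" "\<lambda>_. 3" "\<lambda>T. card (walls T)"] three_walls nc by (simp add: mult.commute)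
  also have "\<dots> \<le> 2 * (\<Sum>i\<in>I. card (edges i (I - {i})))" by (rule sum_card_walls)
  also have "(\<Sum>i\<in>I. card (edges i (I - {i}))) = (\<Sum>i\<in>I. card (vertices_on i (I - {i})))"
  proof (rule sum.cong)
    fix l assume "l \<in> I"
    then show "card (edges l (I - {l})) = card (vertices_on l (I - {l}))"
      using i j by (intro edges_vertices(1)) auto
  qed simp
  also have "\<dots> = (\<Sum>i\<in>I. \<Sum>v\<in>vertices. if sg i v = 0 then 1 else 0)"
  proof (rule sum.cong)
    fix l assume l: "l \<in> I"
    have "vertices_on l (I - {l}) = {v \<in> vertices. sg l v = 0}"
    proof
      show "vertices_on l (I - {l}) \<subseteq> {v \<in> vertices. sg l v = 0}"
        using l vertices_eq by (auto simp: vertices_on_def)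
      show "{v \<in> vertices. sg l v = 0} \<subseteq> vertices_on l (I - {l})"
        using l unfolding vertices_eq vertices_on_def by blast
    qed
    then show "card (vertices_on l (I - {l})) = (\<Sum>v\<in>vertices. if sg l v = 0 then 1 else 0)"
      using finite_vertices by (simp add: sum.If_cases Int_def)
  qed simp
  also have "\<dots> = (\<Sum>v\<in>vertices. \<Sum>i\<in>I. if sg i v = 0 then 1 else 0)" by (rule sum.swap)
  also have "\<dots> = (\<Sum>v\<in>vertices. degree I v)"
    using finite_I by (simp add: degree_def sum.If_cases Int_def)
  finally have 1: "3 * card (topes I) \<le> 2 * (\<Sum>v\<in>vertices. degree I v)" .
  have "(\<Sum>v\<in>vertices. degree I v) = (\<Sum>v\<in>vertices. degree I v - 1) + card vertices"
  proof -
    have "(\<Sum>v\<in>vertices. degree I v) = (\<Sum>v\<in>vertices. (degree I v - 1) + 1)"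
      by (rule sum.cong) (auto simp: vertices_def)
    then show ?thesis by (simp only: sum.distrib) simp
  qed
  moreover have "2 + (\<Sum>v\<in>vertices. degree I v - 1) \<le> card (topes I)"
    by (rule topes_lower_bound) (use i finite_I in auto)
  ultimately show ?thesis using 1 by linarith
qed

end


section \<open>Lifting pseudolines to the sphere\<close>

lemma rp2_of_eq_iff: "x \<in> S2 \<Longrightarrow> y \<in> S2 \<Longrightarrow> rp2_of x = rp2_of y \<longleftrightarrow> x = y \<or> x = - y"
  unfolding rp2_of_def S2_def by (subst Abs_rp2_inject) (auto simp: doubleton_eq_iff)

lemma rp2_of_minus: "rp2_of (- x) = rp2_of x"
  by (simp add: rp2_of_def insert_commute)

lemma rp2_of_surj: obtains x where "x \<in> S2" "r = rp2_of x"
  by (cases r) (auto simp: rp2_of_def S2_def)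

lemma open_rp2_iff: "open U \<longleftrightarrow> openin (top_of_set S2) {x \<in> S2. rp2_of x \<in> U}"
  by (simp add: open_rp2_def S2_def)

lemma continuous_on_rp2_of: "continuous_on S2 rp2_of"
proof -
  have "openin (top_of_set S2) (S2 \<inter> rp2_of -` U)" if "open U" for U
    using that by (simp add: open_rp2_iff vimage_def Int_def)
  then show ?thesis by (simp add: continuous_on_open_gen[of _ _ UNIV])
qed

lemma openin_S2_uminus: "openin (top_of_set S2) W \<Longrightarrow> openin (top_of_set S2) (uminus ` W)"
proof -
  assume "openin (top_of_set S2) W"
  then obtain T where T: "open T" "W = S2 \<inter> T" by (auto simp: openin_open)
  have "x \<in> uminus ` W \<longleftrightarrow> - x \<in> W" for x by force
  then have "uminus ` W = S2 \<inter> uminus ` T"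
    using T minus_S2 by (force simp: image_iff set_eq_iff)
  then show ?thesis using open_negations[OF T(1)] by (auto simp: openin_open)
qed

text \<open>The preimage of the image is \<open>W\<close> together with its antipodal copy.\<close>

lemma open_rp2_of_image:
  assumes "openin (top_of_set S2) W"
  shows "open (rp2_of ` W)"
proof -
  have W: "W \<subseteq> S2" using openin_imp_subset[OF assms] .
  have "{x \<in> S2. rp2_of x \<in> rp2_of ` W} = W \<union> uminus ` W"
  proof -
    have "x \<in> uminus ` W \<longleftrightarrow> - x \<in> W" for x by force
    moreover have "rp2_of x \<in> rp2_of ` W \<longleftrightarrow> x \<in> W \<or> - x \<in> W" if "x \<in> S2" for x
      using W that rp2_of_eq_iff[OF that] rp2_of_minus[of x]
      by (smt (verit, best) image_iff subsetD minus_minus)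
    ultimately show ?thesis using W by auto
  qed
  then show ?thesis unfolding open_rp2_iff using assms openin_S2_uminus by (simp add: openin_Un)
qed

text \<open>An open hemisphere contains no antipodal pair, so the double cover is injective on it
  and \<open>local_section\<close> inverts it there.\<close>

definition chart_domain :: "real ^ 3 \<Rightarrow> rp2 set" where
  "chart_domain p = rp2_of ` {y \<in> S2. 0 < y \<bullet> p}"

definition local_section :: "real ^ 3 \<Rightarrow> rp2 \<Rightarrow> real ^ 3" where
  "local_section p r = (THE y. y \<in> S2 \<and> 0 < y \<bullet> p \<and> rp2_of y = r)"

lemma hemisphere_open: "openin (top_of_set S2) {y \<in> S2. 0 < y \<bullet> p}"
proof -
  have "{y \<in> S2. 0 < y \<bullet> p} = S2 \<inter> {y. 0 < y \<bullet> p}" by auto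
  moreover have "open {y. 0 < y \<bullet> p}"
    using open_halfspace_gt[of 0 p] by (simp add: inner_commute)
  ultimately show ?thesis by (auto simp: openin_open)
qed

lemma open_chart_domain: "open (chart_domain p)"
  unfolding chart_domain_def by (rule open_rp2_of_image[OF hemisphere_open])

lemma local_section_eq: "y \<in> S2 \<Longrightarrow> 0 < y \<bullet> p \<Longrightarrow> local_section p (rp2_of y) = y"
  unfolding local_section_def by (rule the_equality) (auto simp: rp2_of_eq_iff)

lemma local_section: "r \<in> chart_domain p \<Longrightarrow> local_section p r \<in> S2 \<and> rp2_of (local_section p r) = r"
  by (auto simp: chart_domain_def local_section_eq)

lemma continuous_on_local_section: "continuous_on (chart_domain p) (local_section p)"
proof -
  have "\<exists>W. open W \<and> W \<inter> chart_domain p = local_section p -` T \<inter> chart_domain p" if T: "open T" for T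
  proof (intro exI conjI)
    let ?W = "rp2_of ` ({y \<in> S2. 0 < y \<bullet> p} \<inter> T)"
    show "open ?W" by (intro open_rp2_of_image openin_Int_open hemisphere_open T)
    show "?W \<inter> chart_domain p = local_section p -` T \<inter> chart_domain p"
      by (auto simp: chart_domain_def local_section_eq) (metis local_section_eq)
  qed
  then show ?thesis unfolding continuous_on_open_invariant by blast
qed

text \<open>Short pieces lift by a local section. Two lifts of adjacent pieces agree at the common
  point up to sign, and the second can be negated, so lifts can be glued; bisection does the
  rest.\<close>

lemma lift_path_rp2:
  assumes g: "continuous_on {0..1} (g :: real \<Rightarrow> rp2)"
  obtains \<gamma> where "continuous_on {0..1} \<gamma>" "\<And>t. t \<in> {0..1} \<Longrightarrow> \<gamma> t \<in> S2 \<and> rp2_of (\<gamma> t) = g t"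
proof -
  \<comment> \<open>The small intervals that \<open>Bolzano\<close> offers around a point may stick
    out of the unit interval; the guard makes \<open>P\<close> vacuous for them.\<close>
  define P where "P a b \<longleftrightarrow> ({a..b} \<subseteq> {0..1} \<longrightarrow>
      (\<exists>\<gamma>. continuous_on {a..b} \<gamma> \<and> (\<forall>t\<in>{a..b}. \<gamma> t \<in> S2 \<and> rp2_of (\<gamma> t) = g t)))" for a b
  have "(0::real) \<le> 1" by simp
  then have "P 0 1"
  proof (induction rule: Bolzano)
    case (trans a b c)
    show ?case unfolding P_def
    proof
      assume sub: "{a..c} \<subseteq> {0..1}"
      have "{a..b} \<subseteq> {0..1}" "{b..c} \<subseteq> {0..1}" using sub trans by auto
      then obtain \<gamma>1 \<gamma>2 where
        1: "continuous_on {a..b} \<gamma>1" "\<And>t. t\<in>{a..b} \<Longrightarrow> \<gamma>1 t \<in> S2 \<and> rp2_of (\<gamma>1 t) = g t" and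
        2: "continuous_on {b..c} \<gamma>2" "\<And>t. t\<in>{b..c} \<Longrightarrow> \<gamma>2 t \<in> S2 \<and> rp2_of (\<gamma>2 t) = g t"
        using trans(1,2) unfolding P_def by blast
      have "\<exists>\<gamma>3. continuous_on {b..c} \<gamma>3 \<and> (\<forall>t\<in>{b..c}. \<gamma>3 t \<in> S2 \<and> rp2_of (\<gamma>3 t) = g t) \<and> \<gamma>3 b = \<gamma>1 b"
      proof (cases "\<gamma>2 b = \<gamma>1 b")
        case True
        then show ?thesis using 2 by blast
      next
        case False
        then have "- \<gamma>2 b = \<gamma>1 b"
          using 1(2)[of b] 2(2)[of b] rp2_of_eq_iff[of "\<gamma>1 b" "\<gamma>2 b"] trans by auto
        then show ?thesis
          using 2 by (intro exI[of _ "\<lambda>t. - \<gamma>2 t"]) (auto intro!: continuous_intros simp: rp2_of_minus)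
      qed
      then obtain \<gamma>3 where
        3: "continuous_on {b..c} \<gamma>3" "\<And>t. t\<in>{b..c} \<Longrightarrow> \<gamma>3 t \<in> S2 \<and> rp2_of (\<gamma>3 t) = g t" "\<gamma>3 b = \<gamma>1 b"
        by blast
      have "continuous_on ({a..b} \<union> {b..c}) (\<lambda>t. if t \<le> b then \<gamma>1 t else \<gamma>3 t)"
        by (rule continuous_on_cases) (use 1 3 in auto)
      moreover have "{a..b} \<union> {b..c} = {a..c}" using trans by auto
      ultimately show "\<exists>\<gamma>. continuous_on {a..c} \<gamma> \<and> (\<forall>t\<in>{a..c}. \<gamma> t \<in> S2 \<and> rp2_of (\<gamma> t) = g t)"
        using 1(2) 3(2) by (intro exI[of _ "\<lambda>t. if t \<le> b then \<gamma>1 t else \<gamma>3 t"]) auto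
    qed
  next
    case (local x)
    obtain p where p: "p \<in> S2" "g x = rp2_of p" using rp2_of_surj by blast
    have "p \<bullet> p = 1" using p(1) by (simp add: S2_def dot_square_norm)
    then have gx: "g x \<in> chart_domain p" using p by (auto simp: chart_domain_def)
    obtain T where T: "open T" "T \<inter> {0..1} = g -` chart_domain p \<inter> {0..1}"
      using g open_chart_domain[of p] unfolding continuous_on_open_invariant by blast
    have "x \<in> T" using T(2) gx local by auto
    then obtain d where d: "d > 0" "ball x d \<subseteq> T" using T(1) open_contains_ball by blast
    have "P a b" if ab: "a \<le> x" "x \<le> b" "b - a < d" for a b
      unfolding P_def
    proof
      assume sub: "{a..b} \<subseteq> {0..1}"
      have W: "g t \<in> chart_domain p" if "t \<in> {a..b}" for t
      proof -
        have "t \<in> ball x d" using that ab by (auto simp: dist_real_def)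
        then show ?thesis using d(2) T(2) sub that by blast
      qed
      have "continuous_on {a..b} (local_section p \<circ> g)"
        by (rule continuous_on_compose)
          (use W sub in \<open>auto intro: continuous_on_subset[OF g] continuous_on_subset[OF continuous_on_local_section]\<close>)
      moreover have "\<forall>t\<in>{a..b}. (local_section p \<circ> g) t \<in> S2 \<and> rp2_of ((local_section p \<circ> g) t) = g t"
        using W local_section by auto
      ultimately show "\<exists>\<gamma>. continuous_on {a..b} \<gamma> \<and> (\<forall>t\<in>{a..b}. \<gamma> t \<in> S2 \<and> rp2_of (\<gamma> t) = g t)"
        by blast
    qed
    then show ?case using d(1) by blast
  qed
  then show ?thesis using that unfolding P_def by auto
qed

text \<open>A lift that closes up would contract in the simply connected sphere, and its projection
  would contract \<open>g\<close>.\<close>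

lemma lift_pseudoline:
  assumes "pseudoline g"
  obtains \<gamma> where "continuous_on {0..1} \<gamma>" "\<And>t. t \<in> {0..1} \<Longrightarrow> \<gamma> t \<in> S2"
    "\<And>t. t \<in> {0..1} \<Longrightarrow> rp2_of (\<gamma> t) = g t" "\<gamma> 1 = - \<gamma> 0"
proof -
  have g: "simple_path g" "g 1 = g 0" and nh: "\<And>a. \<not> homotopic_loops UNIV g (\<lambda>_. a)"
    using assms by (auto simp: pseudoline_def pathfinish_def pathstart_def)
  have "continuous_on {0..1} g" using simple_path_imp_path[OF g(1)] by (simp add: path_def)
  then obtain \<gamma> where \<gamma>: "continuous_on {0..1} \<gamma>" "\<And>t. t \<in> {0..1} \<Longrightarrow> \<gamma> t \<in> S2 \<and> rp2_of (\<gamma> t) = g t"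
    using lift_path_rp2 by metis
  have "\<gamma> 1 \<noteq> \<gamma> 0"
  proof
    assume loop: "\<gamma> 1 = \<gamma> 0"
    have "simply_connected S2" unfolding S2_def by (rule simply_connected_sphere) simp
    moreover have p: "path \<gamma>" "path_image \<gamma> \<subseteq> S2" "pathfinish \<gamma> = pathstart \<gamma>"
      using \<gamma> loop by (auto simp: path_def path_image_def pathfinish_def pathstart_def)
    ultimately obtain a where "homotopic_loops S2 \<gamma> (linepath a a)"
      by (metis simply_connected_eq_contractible_loop_some)
    then have h: "homotopic_loops UNIV (rp2_of \<circ> \<gamma>) (rp2_of \<circ> linepath a a)"
      by (rule homotopic_loops_continuous_image) (auto simp: continuous_on_rp2_of)
    have "homotopic_loops UNIV g (rp2_of \<circ> \<gamma>)"
      by (rule homotopic_loops_eq)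
        (use \<gamma> g simple_path_imp_path in \<open>auto simp: pathfinish_def pathstart_def\<close>)
    then have "homotopic_loops UNIV g (rp2_of \<circ> linepath a a)" using h homotopic_loops_trans by blast
    moreover have "rp2_of \<circ> linepath a a = (\<lambda>_. rp2_of a)" by (auto simp: linepath_refl)
    ultimately show False using nh by simp
  qed
  moreover have "\<gamma> 1 = \<gamma> 0 \<or> \<gamma> 1 = - \<gamma> 0"
    using \<gamma>(2)[of 0] \<gamma>(2)[of 1] g(2) rp2_of_eq_iff[of "\<gamma> 1" "\<gamma> 0"] by auto
  ultimately show ?thesis using that \<gamma> by blast
qed

section \<open>The two sides of a lifted pseudoline\<close>

text \<open>What a single pseudoline provides on the sphere. Oddness of \<open>\<sigma>\<close> is
  absent because its proof needs a second pseudoline.\<close>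

locale sphere_lift =
  fixes C :: "rp2 set" and \<gamma> :: "real \<Rightarrow> real ^ 3" and \<sigma> :: "real ^ 3 \<Rightarrow> int"
  assumes curve_cont: "continuous_on {0..1} \<gamma>"
    and curve_S2: "t \<in> {0..1} \<Longrightarrow> \<gamma> t \<in> S2"
    and curve_1: "\<gamma> 1 = - \<gamma> 0"
    and curve_inj: "\<lbrakk>s \<in> {0..<1}; t \<in> {0..<1}; \<gamma> s = \<gamma> t \<or> \<gamma> s = - \<gamma> t\<rbrakk> \<Longrightarrow> s = t"
    and curve_image: "{x \<in> S2. rp2_of x \<in> C} = \<gamma> ` {0..<1} \<union> uminus ` \<gamma> ` {0..<1}"
    and side_values: "x \<in> S2 \<Longrightarrow> \<sigma> x \<in> {-1, 0, 1}"
    and side_zero: "x \<in> S2 \<Longrightarrow> \<sigma> x = 0 \<longleftrightarrow> rp2_of x \<in> C"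
    and side_open: "e \<noteq> 0 \<Longrightarrow> openin (top_of_set S2) {x \<in> S2. \<sigma> x = e}"
    and side_connected: "e \<noteq> 0 \<Longrightarrow> connected {x \<in> S2. \<sigma> x = e}"
    and side_dense: "\<lbrakk>x \<in> S2; rp2_of x \<in> C; openin (top_of_set S2) W; x \<in> W; e \<in> {-1, 1}\<rbrakk>
      \<Longrightarrow> \<exists>y\<in>W. \<sigma> y = e"

text \<open>The lift followed by its antipodal copy is a simple closed curve, and its two Jordan
  sides get the signs 1 and -1. A point off the pseudoline ensures that the curve does not fill the
  sphere.\<close>

lemma pseudoline_sphere_lift:
  assumes g: "pseudoline g" and ne: "path_image g \<noteq> UNIV"
  shows "\<exists>\<gamma> \<sigma>. sphere_lift (path_image g) \<gamma> \<sigma>"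
proof -
  obtain \<gamma> where \<gamma>: "continuous_on {0..1} \<gamma>" "\<And>t. t \<in> {0..1} \<Longrightarrow> \<gamma> t \<in> S2"
    "\<And>t. t \<in> {0..1} \<Longrightarrow> rp2_of (\<gamma> t) = g t" "\<gamma> 1 = - \<gamma> 0"
    using lift_pseudoline[OF g] by metis
  have lf: "loop_free g" and g1: "g 1 = g 0" using g by (auto simp: pseudoline_def simple_path_def pathfinish_def pathstart_def)
  have inj: "s = t" if st: "s \<in> {0..<1}" "t \<in> {0..<1}" "\<gamma> s = \<gamma> t \<or> \<gamma> s = - \<gamma> t" for s t
  proof -
    have "rp2_of (\<gamma> s) = rp2_of (\<gamma> t)" using st(3) rp2_of_minus by metis
    then have "g s = g t" using \<gamma>(3)[of s] \<gamma>(3)[of t] st by auto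
    then show ?thesis using lf st unfolding loop_free_def by fastforce
  qed
  let ?Z = "{x \<in> S2. rp2_of x \<in> path_image g}"
  have Z: "?Z = \<gamma> ` {0..<1} \<union> uminus ` \<gamma> ` {0..<1}"
  proof
    show "?Z \<subseteq> \<gamma> ` {0..<1} \<union> uminus ` \<gamma> ` {0..<1}"
    proof
      fix x assume x: "x \<in> ?Z"
      then obtain t where t: "t \<in> {0..1}" "rp2_of x = g t" by (auto simp: path_image_def)
      obtain u where u: "u \<in> {0..<1}" "g t = g u"
        using t(1) g1 by (cases "t = 1") (auto intro: that[of 0] that[of t])
      have "rp2_of x = rp2_of (\<gamma> u)" using t(2) u \<gamma>(3)[of u] by auto
      then have "x = \<gamma> u \<or> x = - \<gamma> u" using rp2_of_eq_iff x \<gamma>(2)[of u] u by auto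
      then show "x \<in> \<gamma> ` {0..<1} \<union> uminus ` \<gamma> ` {0..<1}" using u by auto
    qed
    have "\<gamma> t \<in> ?Z \<and> - \<gamma> t \<in> ?Z" if "t \<in> {0..<1}" for t
      using that \<gamma>(2,3)[of t] rp2_of_minus[of "\<gamma> t"] by (auto simp: path_image_def)
    then show "\<gamma> ` {0..<1} \<union> uminus ` \<gamma> ` {0..<1} \<subseteq> ?Z" by auto
  qed
  define c where "c = \<gamma> +++ (\<lambda>t. - \<gamma> t)"
  have join: "pathfinish \<gamma> = pathstart (\<lambda>t. - \<gamma> t)" "pathfinish (\<lambda>t. - \<gamma> t) = pathstart \<gamma>"
    using \<gamma>(4) by (auto simp: pathfinish_def pathstart_def)
  have injg: "inj_on \<gamma> {0..1}"
  proof (rule inj_onI)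
    fix s t assume st: "s \<in> {0..1}" "t \<in> {0..1}" "\<gamma> s = \<gamma> t"
    consider "s < 1" "t < 1" | "s = 1" "t < 1" | "s < 1" "t = 1" | "s = t" using st by force
    then show "s = t"
    proof cases
      case 1
      then show ?thesis using inj st by auto
    next
      case 2
      then have "t = 0" using inj[of t 0] st \<gamma>(4) by auto
      then show ?thesis using st 2 \<gamma>(4) S2_neq_minus[OF \<gamma>(2)[of 0]] by auto
    next
      case 3
      then have "s = 0" using inj[of s 0] st \<gamma>(4) by auto
      then show ?thesis using st 3 \<gamma>(4) S2_neq_minus[OF \<gamma>(2)[of 0]] by auto
    qed
  qed
  have "arc \<gamma>" using \<gamma>(1) injg by (simp add: arc_def path_def)
  moreover have "arc (\<lambda>t. - \<gamma> t)" using \<gamma>(1) injg by (auto simp: arc_def path_def inj_on_def intro!: continuous_intros)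
  moreover have "path_image \<gamma> \<inter> path_image (\<lambda>t. - \<gamma> t) \<subseteq> {pathstart \<gamma>, pathstart (\<lambda>t. - \<gamma> t)}"
  proof
    fix x assume "x \<in> path_image \<gamma> \<inter> path_image (\<lambda>t. - \<gamma> t)"
    then obtain s t where st: "s \<in> {0..1}" "t \<in> {0..1}" "x = \<gamma> s" "x = - \<gamma> t" by (auto simp: path_image_def)
    consider "s < 1" "t < 1" | "s = 1" | "t = 1" using st by force
    then show "x \<in> {pathstart \<gamma>, pathstart (\<lambda>t. - \<gamma> t)}"
    proof cases
      case 1
      then have "s = t" using inj st by auto
      then show ?thesis using st S2_neq_minus[OF \<gamma>(2)[OF st(2)]] by metis
    qed (use st \<gamma>(4) in \<open>auto simp: pathstart_def\<close>)
  qed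
  ultimately have "simple_path c" unfolding c_def using join by (intro simple_path_join_loop)
  moreover have "pathfinish c = pathstart c" unfolding c_def using join by simp
  moreover have pc: "path_image c = ?Z"
  proof -
    have "path_image c = \<gamma> ` {0..1} \<union> uminus ` \<gamma> ` {0..1}"
      unfolding c_def path_image_join[OF join(1)] by (auto simp: path_image_def)
    also have "{0..1} = insert 1 {0..<1::real}" by auto
    finally have "path_image c = insert (\<gamma> 1) (insert (- \<gamma> 1) (\<gamma> ` {0..<1} \<union> uminus ` \<gamma> ` {0..<1}))" by auto
    also have "\<dots> = \<gamma> ` {0..<1} \<union> uminus ` \<gamma> ` {0..<1}" unfolding \<gamma>(4) by force
    finally show ?thesis using Z by simp
  qed
  moreover have "?Z \<noteq> S2"
  proof -
    obtain r where r: "r \<notin> path_image g" using ne by auto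
    obtain x where "x \<in> S2" "r = rp2_of x" using rp2_of_surj by blast
    then show ?thesis using r by auto
  qed
  ultimately obtain U V where UV: "openin (top_of_set S2) U" "openin (top_of_set S2) V" "connected U" "connected V"
    "U \<inter> V = {}" "U \<union> V = S2 - ?Z"
    "\<And>x W. x \<in> ?Z \<Longrightarrow> openin (top_of_set S2) W \<Longrightarrow> x \<in> W \<Longrightarrow> W \<inter> U \<noteq> {} \<and> W \<inter> V \<noteq> {}"
    using Jordan_S2[of c] by (metis (no_types, lifting) mem_Collect_eq subsetI)
  define \<sigma> :: "real ^ 3 \<Rightarrow> int" where "\<sigma> x = (if x \<in> U then 1 else if x \<in> V then -1 else 0)" for x
  have \<sigma>1: "\<sigma> x = 1 \<longleftrightarrow> x \<in> U" "\<sigma> x = -1 \<longleftrightarrow> x \<in> V" for x using UV(5) by (auto simp: \<sigma>_def)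
  have lev: "{x \<in> S2. \<sigma> x = e} = (if e = 1 then U else if e = -1 then V else {})" if "e \<noteq> 0" for e
    using that UV(5,6) by (auto simp: \<sigma>_def split: if_splits)
  have zero: "\<sigma> x = 0 \<longleftrightarrow> rp2_of x \<in> path_image g" if "x \<in> S2" for x
    using that UV(6) by (auto simp: \<sigma>_def set_eq_iff)
  have "sphere_lift (path_image g) \<gamma> \<sigma>"
  proof
    fix x W and e :: int
    assume x: "x \<in> S2" "rp2_of x \<in> path_image g" "openin (top_of_set S2) W" "x \<in> W" "e \<in> {-1, 1}"
    then have "W \<inter> U \<noteq> {}" "W \<inter> V \<noteq> {}" using UV(7)[of x W] by auto
    then show "\<exists>y\<in>W. \<sigma> y = e" using x(5) \<sigma>1 by auto
  next
    fix x show "\<sigma> x \<in> {-1, 0, 1}" by (auto simp: \<sigma>_def)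
  qed (use \<gamma> inj Z zero lev UV(1-4) in auto)
  then show ?thesis by blast
qed

lemma (in sphere_lift) sign_const:
  assumes "connected K" "K \<subseteq> S2" "\<And>x. x \<in> K \<Longrightarrow> rp2_of x \<notin> C" "x \<in> K" "y \<in> K"
  shows "\<sigma> x = \<sigma> y"
  by (rule sign_const_on_connected[OF side_open side_values assms(1,2) _ assms(4,5)])
    (use assms side_zero in auto)

text \<open>Near the crossing point \<open>B\<close> runs on both sides of \<open>C\<close>: the chart maps \<open>C\<close> to
  the horizontal axis, so the two half discs lift to opposite sides.\<close>

lemma (in sphere_lift) crossing_curve_both_sides:
  assumes cr: "cross_at C B p"
  shows "\<exists>x\<in>S2. \<exists>y\<in>S2. rp2_of x \<in> B \<and> rp2_of y \<in> B \<and> \<sigma> x = 1 \<and> \<sigma> y = -1"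
proof -
  obtain P where P: "P \<in> S2" "p = rp2_of P" using rp2_of_surj by blast
  obtain U h h' where U: "open U" and h: "homeomorphism U (UNIV :: (real \<times> real) set) h h'"
    and p: "p \<in> U" "h p = (0, 0)" and hA: "h ` (C \<inter> U) = UNIV \<times> {0}" and hB: "h ` (B \<inter> U) = {0} \<times> UNIV"
    using cr unfolding cross_at_def by blast
  have hc: "continuous_on UNIV h'" and inv: "\<And>x. x \<in> U \<Longrightarrow> h' (h x) = x" "\<And>z. h (h' z) = z" "\<And>z. h' z \<in> U"
    using h by (auto simp: homeomorphism_def)
  have inC: "h' z \<in> C \<longleftrightarrow> snd z = 0" for z
  proof
    assume "h' z \<in> C"
    then have "h (h' z) \<in> h ` (C \<inter> U)" using inv(3) by blast
    then show "snd z = 0" using hA inv(2) by auto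
  next
    assume "snd z = 0"
    then have "z \<in> h ` (C \<inter> U)" using hA by (cases z) auto
    then show "h' z \<in> C" using inv(1) by auto
  qed
  have inB: "h' z \<in> B" if "fst z = 0" for z
  proof -
    have "z \<in> h ` (B \<inter> U)" using hB that by (cases z) auto
    then show ?thesis using inv(1) by auto
  qed
  let ?W = "chart_domain P"
  have "P \<bullet> P = 1" using P(1) by (simp add: S2_def dot_square_norm)
  then have pW: "p \<in> ?W" using P by (auto simp: chart_domain_def)
  have "openin (top_of_set U) (U \<inter> ?W)" using open_chart_domain by (simp add: openin_open_Int)
  then have "open (h ` (U \<inter> ?W))" using homeomorphism_imp_open_map[OF h] by fastforce
  moreover have "(0, 0) \<in> h ` (U \<inter> ?W)" using p pW by force
  \<comment> \<open>The disc is small enough for a single local section \<open>?s\<close> to lift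
    all of it to the hemisphere around \<open>P\<close>.\<close>
  ultimately obtain r where r: "r > 0" "ball (0, 0) r \<subseteq> h ` (U \<inter> ?W)"
    using open_contains_ball by blast
  have hW: "h' z \<in> ?W" if "z \<in> ball (0, 0) r" for z using r(2) that inv(1) by auto
  let ?s = "\<lambda>z. local_section P (h' z)"
  have sec: "?s z \<in> S2" "rp2_of (?s z) = h' z" if "z \<in> ball (0, 0) r" for z
    using local_section[OF hW[OF that]] by auto
  have sz: "\<sigma> (?s z) = 0 \<longleftrightarrow> snd z = 0" if "z \<in> ball (0, 0) r" for z
    using side_zero[OF sec(1)[OF that]] sec(2)[OF that] inC by simp
  \<comment> \<open>For \<open>e\<close> equal to 1 and -1, the upper and lower half disc. The lift
    of each is connected and misses \<open>C\<close>, so \<open>\<sigma>\<close> is constant on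
    it.\<close>
  define Q where "Q e = ball (0, 0) r \<inter> {z :: real \<times> real. 0 < e * snd z}" for e :: real
  have cQ: "connected (Q e)" for e
  proof -
    have "{z :: real \<times> real. 0 < e * snd z} = {z. (0, e) \<bullet> z > 0}" by (auto simp: inner_prod_def)
    then have "convex (Q e)" unfolding Q_def
      by (intro convex_Int convex_ball) (simp add: convex_halfspace_gt)
    then show ?thesis by (rule convex_connected)
  qed
  have const: "\<sigma> (?s z) = \<sigma> (?s w)" if "z \<in> Q e" "w \<in> Q e" for z w e
  proof (rule sign_const[of "?s ` Q e"])
    have "continuous_on (Q e) h'" using hc continuous_on_subset by blast
    moreover have "continuous_on (h' ` Q e) (local_section P)"
      by (rule continuous_on_subset[OF continuous_on_local_section]) (use hW in \<open>auto simp: Q_def\<close>)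
    ultimately have "continuous_on (Q e) ?s" using continuous_on_compose[of "Q e" h' "local_section P"] by (simp add: o_def)
    then show "connected (?s ` Q e)" using cQ connected_continuous_image by blast
    show "?s ` Q e \<subseteq> S2" using sec by (auto simp: Q_def)
    show "rp2_of x \<notin> C" if "x \<in> ?s ` Q e" for x using that sec inC by (auto simp: Q_def)
  qed (use that in auto)
  define W where "W = {y \<in> S2. 0 < y \<bullet> P} \<inter> {y \<in> S2. rp2_of y \<in> h' ` ball (0, 0) r}"
  have "openin (top_of_set U) (h' ` ball (0, 0) r)"
    by (rule homeomorphism_imp_open_map[OF homeomorphism_symD[OF h]]) simp
  then have "open (h' ` ball (0, 0) r)" using U openin_open_eq by blast
  then have oW: "openin (top_of_set S2) W"
    unfolding W_def using open_rp2_iff hemisphere_open by blast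
  have "h' (0, 0) = p" using inv(1) p by metis
  then have "rp2_of P \<in> h' ` ball (0, 0) r" using P r(1) by (metis centre_in_ball imageI)
  then have PW: "P \<in> W" using P \<open>P \<bullet> P = 1\<close> by (simp add: W_def)
  have "p \<in> C" using inC[of "(0, 0)"] \<open>h' (0, 0) = p\<close> by simp
  then have dense: "\<exists>y\<in>W. \<sigma> y = e" if "e \<in> {-1, 1}" for e
    using side_dense[OF P(1) _ oW PW that] P(2) by simp
  \<comment> \<open>Both signs occur arbitrarily close to \<open>P\<close>, and there every point
    off the curve comes from a half disc. So some half disc carries the sign 1 and some the sign
    -1.\<close>
  have WQ: "\<exists>d\<in>{-1, 1}. \<exists>z\<in>Q d. y = ?s z" if y: "y \<in> W" "\<sigma> y \<noteq> 0" for y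
  proof -
    obtain z where z: "z \<in> ball (0, 0) r" "rp2_of y = h' z" using y by (auto simp: W_def)
    have "y = ?s z" using local_section_eq[of y P] y z by (auto simp: W_def)
    moreover then have "snd z \<noteq> 0" using sz[OF z(1)] y by simp
    then have "z \<in> Q 1 \<or> z \<in> Q (-1)" using z(1) by (auto simp: Q_def)
    ultimately show ?thesis by blast
  qed
  obtain y1 where y1: "y1 \<in> W" "\<sigma> y1 = 1" using dense[of 1] by auto
  obtain y2 where y2: "y2 \<in> W" "\<sigma> y2 = -1" using dense[of "-1"] by auto
  obtain d1 z1 where d1: "d1 \<in> {-1, 1}" "z1 \<in> Q d1" "y1 = ?s z1" using WQ[OF y1(1)] y1(2) by auto
  obtain d2 z2 where d2: "d2 \<in> {-1, 1}" "z2 \<in> Q d2" "y2 = ?s z2" using WQ[OF y2(1)] y2(2) by auto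
  \<comment> \<open>A point of the half disc on the vertical axis, hence on
    \<open>B\<close>.\<close>
  have wQ: "(0, d * r / 2) \<in> Q d" if "d \<in> {-1, 1}" for d
  proof -
    have "dist (0, 0) (0 :: real, d * r / 2) = r / 2" using that r(1) by (auto simp: dist_Pair_Pair dist_real_def)
    then show ?thesis using that r(1) by (auto simp: Q_def)
  qed
  have "\<sigma> (?s (0, d1 * r / 2)) = 1" using const[OF wQ[OF d1(1)] d1(2)] d1(3) y1 by simp
  moreover have "\<sigma> (?s (0, d2 * r / 2)) = -1" using const[OF wQ[OF d2(1)] d2(2)] d2(3) y2 by simp
  moreover have "(0 :: real, d * r / 2) \<in> ball (0, 0) r" if "d \<in> {-1, 1}" for d
    using wQ[OF that] by (simp add: Q_def)
  ultimately show ?thesis using sec inB d1(1) d2(1) by (metis fst_conv)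
qed

text \<open>\<open>K\<close> is an open arc of the lifted curve between the two lifts of \<open>p\<close>.\<close>

lemma (in sphere_lift) arc_between_antipodes:
  assumes "p \<in> C"
  obtains K where "connected K" "K \<subseteq> S2" "\<And>x. x \<in> K \<Longrightarrow> rp2_of x \<in> C - {p}"
    "\<And>x. x \<in> S2 \<Longrightarrow> rp2_of x \<in> C - {p} \<Longrightarrow> x \<in> K \<or> - x \<in> K"
proof -
  obtain P where P: "P \<in> S2" "p = rp2_of P" using rp2_of_surj by blast
  then have "P \<in> {x \<in> S2. rp2_of x \<in> C}" using assms by auto
  then obtain t where t: "t \<in> {0..<1}" "P = \<gamma> t \<or> P = - \<gamma> t" unfolding curve_image by auto
  then have pt: "p = rp2_of (\<gamma> t)" using P(2) rp2_of_minus by auto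
  have inC: "rp2_of (\<gamma> s) \<in> C" if "s \<in> {0..<1}" for s using curve_image that by blast
  have np: "rp2_of (\<gamma> s) \<noteq> p" if "s \<in> {0..<1}" "s \<noteq> t" for s
    using that t(1) curve_inj[OF that(1) t(1)] rp2_of_eq_iff[of "\<gamma> s" "\<gamma> t"] curve_S2[of s] curve_S2[of t] pt by auto
  have r1: "rp2_of (\<gamma> 1) = rp2_of (\<gamma> 0)" using curve_1 rp2_of_minus by metis
  \<comment> \<open>Unless \<open>p\<close> is the base point, the arc runs through the seam where
    \<open>\<gamma> 1\<close> is \<open>- \<gamma> 0\<close>.\<close>
  define K where "K = (if t = 0 then \<gamma> ` {0<..<1} else \<gamma> ` {t<..1} \<union> (\<lambda>s. - \<gamma> s) ` {0..<t})"
  have cont: "continuous_on X \<gamma>" "continuous_on X (\<lambda>s. - \<gamma> s)" if "X \<subseteq> {0..1}" for X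
    using continuous_on_subset[OF curve_cont that] by (auto intro: continuous_intros)
  have "connected K"
  proof (cases "t = 0")
    case True
    then show ?thesis unfolding K_def by (auto intro!: connected_continuous_image cont)
  next
    case False
    have "connected (\<gamma> ` {t<..1})" "connected ((\<lambda>s. - \<gamma> s) ` {0..<t})"
      using t(1) by (auto intro!: connected_continuous_image cont)
    moreover have "\<gamma> 1 \<in> \<gamma> ` {t<..1}" "- \<gamma> 0 \<in> (\<lambda>s. - \<gamma> s) ` {0..<t}" using t(1) False by auto
    ultimately have "connected (\<gamma> ` {t<..1} \<union> (\<lambda>s. - \<gamma> s) ` {0..<t})"
      by (intro connected_Un) (use curve_1 in auto)
    then show ?thesis using False by (simp add: K_def)
  qed
  moreover have "K \<subseteq> S2" using curve_S2 t(1) by (auto simp: K_def)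
  moreover have "rp2_of x \<in> C - {p}" if xK: "x \<in> K" for x
  proof (cases "t = 0")
    case True
    then obtain s where "x = \<gamma> s" "s \<in> {0<..<1}" using xK by (auto simp: K_def)
    then show ?thesis using inC[of s] np[of s] True by auto
  next
    case False
    have "rp2_of (\<gamma> s) \<in> C - {p}" if "s \<in> {t<..1}" for s
      using that inC[of s] np[of s] inC[of 0] np[of 0] r1 t(1) False by (cases "s = 1") auto
    moreover have "rp2_of (- \<gamma> s) \<in> C - {p}" if "s \<in> {0..<t}" for s
      using that inC[of s] np[of s] t(1) rp2_of_minus by auto
    moreover have "x \<in> \<gamma> ` {t<..1} \<union> (\<lambda>s. - \<gamma> s) ` {0..<t}"
      using xK False by (simp add: K_def)
    ultimately show ?thesis by blast
  qed
  moreover have "x \<in> K \<or> - x \<in> K" if x: "x \<in> S2" "rp2_of x \<in> C - {p}" for x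
  proof -
    have "x \<in> {x \<in> S2. rp2_of x \<in> C}" using x by auto
    then obtain s where s: "s \<in> {0..<1}" "x = \<gamma> s \<or> x = - \<gamma> s" unfolding curve_image by auto
    have "rp2_of x = rp2_of (\<gamma> s)" using s(2) rp2_of_minus by metis
    then have "s \<noteq> t" using x(2) pt by auto
    then show ?thesis using s t(1) by (force simp: K_def)
  qed
  ultimately show ?thesis using that by blast
qed

text \<open>Without \<open>p\<close>, the curve \<open>B\<close> lifts to the arcs \<open>K\<close>
  and \<open>- K\<close>, which avoid \<open>A\<close> and so have one sign each. As
  \<open>B\<close> has points on both sides of \<open>A\<close>, these signs are opposite. This
  yields one point on the side opposite to its antipode, and connectedness of the sides spreads it
  to all points.\<close>

lemma sphere_lift_odd:
  assumes A: "sphere_lift A \<gamma> \<sigma>" and B: "sphere_lift B \<gamma>' \<sigma>'"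
    and AB: "A \<inter> B = {p}" "cross_at A B p" and x: "x \<in> S2"
  shows "\<sigma> (- x) = - \<sigma> x"
proof -
  interpret A: sphere_lift A \<gamma> \<sigma> by fact
  interpret B: sphere_lift B \<gamma>' \<sigma>' by fact
  have pAB: "p \<in> A" "p \<in> B" using AB by auto
  obtain K where K: "connected K" "K \<subseteq> S2" "\<And>x. x \<in> K \<Longrightarrow> rp2_of x \<in> B - {p}"
    "\<And>x. x \<in> S2 \<Longrightarrow> rp2_of x \<in> B - {p} \<Longrightarrow> x \<in> K \<or> - x \<in> K"
    using B.arc_between_antipodes[OF pAB(2)] by metis
  have nA: "rp2_of x \<notin> A" if "x \<in> K" for x using K(3)[OF that] AB by auto
  have constK: "\<sigma> x = \<sigma> y" if "x \<in> K" "y \<in> K" for x y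
    by (rule A.sign_const[OF K(1,2) nA that])
  have constK': "\<sigma> (- x) = \<sigma> (- y)" if "x \<in> K" "y \<in> K" for x y
    by (rule A.sign_const[of "uminus ` K"])
      (use that K nA in \<open>auto simp: rp2_of_minus intro!: connected_continuous_image continuous_intros\<close>)
  obtain b1 b2 where b: "b1 \<in> S2" "b2 \<in> S2" "rp2_of b1 \<in> B" "rp2_of b2 \<in> B" "\<sigma> b1 = 1" "\<sigma> b2 = -1"
    using A.crossing_curve_both_sides[OF AB(2)] by blast
  have "rp2_of b1 \<notin> A" "rp2_of b2 \<notin> A" using A.side_zero[OF b(1)] A.side_zero[OF b(2)] b by auto
  then have "b1 \<in> K \<or> - b1 \<in> K" "b2 \<in> K \<or> - b2 \<in> K" using K(4) b pAB by auto
  moreover have "\<not> (b1 \<in> K \<and> b2 \<in> K)" using constK[of b1 b2] b by auto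
  moreover have "\<not> (- b1 \<in> K \<and> - b2 \<in> K)" using constK'[of "- b1" "- b2"] b by auto
  ultimately have "\<exists>y\<in>S2. \<sigma> y = 1 \<and> \<sigma> (- y) = -1"
    using constK[of b1 "- b2"] constK[of "- b1" b2] b by (metis minus_S2 minus_minus)
  then obtain y where y: "y \<in> S2" "\<sigma> y = 1" "\<sigma> (- y) = -1" by blast
  \<comment> \<open>The antipodal image of a side is connected and still avoids \<open>A\<close>, so
    it stays within one side.\<close>
  have flip: "\<sigma> (- z) = \<sigma> (- w)" if "z \<in> S2" "w \<in> S2" "\<sigma> z = \<sigma> w" "\<sigma> z \<noteq> 0" for z w
  proof (rule A.sign_const[of "uminus ` {x \<in> S2. \<sigma> x = \<sigma> z}"])
    show "connected (uminus ` {x \<in> S2. \<sigma> x = \<sigma> z})"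
      by (intro connected_continuous_image continuous_intros A.side_connected that)
    show "rp2_of u \<notin> A" if "u \<in> uminus ` {x \<in> S2. \<sigma> x = \<sigma> z}" for u
    proof -
      have "- u \<in> S2" "\<sigma> (- u) \<noteq> 0" using that \<open>\<sigma> z \<noteq> 0\<close> by auto
      then show ?thesis using A.side_zero[of "- u"] by (simp add: rp2_of_minus)
    qed
  qed (use that in auto)
  show ?thesis
  proof -
    consider "\<sigma> x = 0" | "\<sigma> x = 1" | "\<sigma> x = -1" using A.side_values[OF x] by auto
    then show ?thesis
    proof cases
      case 1
      then show ?thesis using A.side_zero[of x] A.side_zero[of "- x"] x rp2_of_minus by auto
    next
      case 2
      then show ?thesis using flip[OF x y(1)] y by auto
    next
      case 3
      then show ?thesis using flip[OF x, of "- y"] y by auto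
    qed
  qed
qed


text \<open>Excludes pseudolines that fill the plane: any other pseudoline would then coincide with
  its single common point.\<close>

lemma pseudoline_not_singleton: "pseudoline g \<Longrightarrow> path_image g \<noteq> {p}"
proof
  assume g: "pseudoline g" "path_image g = {p}"
  then have "loop_free g" by (simp add: pseudoline_def simple_path_def)
  moreover have "g t = p" if "t \<in> {0..1}" for t using g(2) that unfolding path_image_def by blast
  then have "g 0 = g (1/2)" by simp
  ultimately show False unfolding loop_free_def by fastforce
qed

lemma arrangement_lifts:
  assumes arr: "pseudoline_arrangement I c" and two: "\<And>i. \<exists>j\<in>I. j \<noteq> i"
  obtains sg gam where "spherical_arrangement I sg gam"
    "\<And>i x. i \<in> I \<Longrightarrow> x \<in> S2 \<Longrightarrow> sg i x = 0 \<longleftrightarrow> rp2_of x \<in> path_image (c i)"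
proof -
  have fin: "finite I" and pl: "\<And>i. i \<in> I \<Longrightarrow> pseudoline (c i)"
    and cr: "\<And>i j. \<lbrakk>i \<in> I; j \<in> I; i \<noteq> j\<rbrakk> \<Longrightarrow> \<exists>p. path_image (c i) \<inter> path_image (c j) = {p} \<and>
      cross_at (path_image (c i)) (path_image (c j)) p"
    using arr unfolding pseudoline_arrangement_def by blast+
  have "\<exists>\<gamma> \<sigma>. sphere_lift (path_image (c i)) \<gamma> \<sigma>" if i: "i \<in> I" for i
  proof (rule pseudoline_sphere_lift[OF pl[OF i]])
    obtain j where j: "j \<in> I" "j \<noteq> i" using two by blast
    show "path_image (c i) \<noteq> UNIV"
      using cr[OF i j(1)] j pseudoline_not_singleton[OF pl[OF j(1)]] by auto
  qed
  then obtain gam sg where lift: "\<And>i. i \<in> I \<Longrightarrow> sphere_lift (path_image (c i)) (gam i) (sg i)"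
    by metis
  note L = sphere_lift.curve_cont[OF lift] sphere_lift.curve_S2[OF lift] sphere_lift.curve_1[OF lift]
    sphere_lift.curve_inj[OF lift] sphere_lift.side_values[OF lift] sphere_lift.side_open[OF lift]
    sphere_lift.side_connected[OF lift]
  note zero = sphere_lift.side_zero[OF lift]
  have "spherical_arrangement I sg gam"
  proof
    show "sg i (- x) = - sg i x" if i: "i \<in> I" and x: "x \<in> S2" for i x
    proof -
      obtain j where j: "j \<in> I" "j \<noteq> i" using two by blast
      then show ?thesis using cr[OF i j(1)] sphere_lift_odd[OF lift[OF i] lift[OF j(1)] _ _ x] by blast
    qed
    show "\<exists>y\<in>W. sg i y = e"
      if "i \<in> I" "x \<in> S2" "sg i x = 0" "openin (top_of_set S2) W" "x \<in> W" "e \<in> {-1, 1}" for i x W e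
      using sphere_lift.side_dense[OF lift[OF that(1)] that(2) _ that(4-6)] zero that by blast
    show "{x \<in> S2. sg i x = 0} = gam i ` {0..<1} \<union> uminus ` gam i ` {0..<1}" if "i \<in> I" for i
      unfolding sphere_lift.curve_image[OF lift[OF that], symmetric] using zero that by blast
    show "\<exists>p\<in>S2. {x \<in> S2. sg i x = 0 \<and> sg j x = 0} = {p, - p}" if ij: "i \<in> I" "j \<in> I" "i \<noteq> j" for i j
    proof -
      obtain q where q: "path_image (c i) \<inter> path_image (c j) = {q}" using cr[OF ij] by blast
      obtain p where p: "p \<in> S2" "q = rp2_of p" using rp2_of_surj by blast
      have "sg i x = 0 \<and> sg j x = 0 \<longleftrightarrow> x = p \<or> x = - p" if "x \<in> S2" for x
        using zero[OF ij(1) that] zero[OF ij(2) that] q rp2_of_eq_iff[OF that p(1)] p(2) by blast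
      then have "{x \<in> S2. sg i x = 0 \<and> sg j x = 0} = {p, - p}" using p(1) minus_S2 by blast
      then show ?thesis using p(1) by blast
    qed
  qed (use fin L in blast)+
  then show ?thesis using that zero by blast
qed


section \<open>Melchior's inequality in the projective plane\<close>

definition incident :: "'a set \<Rightarrow> ('a \<Rightarrow> real \<Rightarrow> rp2) \<Rightarrow> rp2 \<Rightarrow> 'a set" where
  "incident I c p = {i \<in> I. p \<in> path_image (c i)}"

definition crossing_points :: "'a set \<Rightarrow> ('a \<Rightarrow> real \<Rightarrow> rp2) \<Rightarrow> rp2 set" where
  "crossing_points I c = {p. 2 \<le> card (incident I c p)}"

text \<open>Every crossing point has two antipodal lifts of the same degree, so each term of the
  spherical inequality is twice the corresponding one here.\<close>

theorem pseudoline_melchior: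
  assumes arr: "pseudoline_arrangement I c" and nc: "\<And>p. \<exists>i\<in>I. p \<notin> path_image (c i)"
  shows "finite (crossing_points I c)"
    and "(\<Sum>p\<in>crossing_points I c. card (incident I c p)) + 3 \<le> 3 * card (crossing_points I c)"
proof -
  \<comment> \<open>A curve that misses some point of \<open>c i\<close> is different from
    \<open>i\<close>.\<close>
  have two: "\<exists>j\<in>I. j \<noteq> i" for i
    using nc[of "c i 0"] by (force simp: path_image_def)
  obtain sg gam where sa: "spherical_arrangement I sg gam"
    and zero: "\<And>i x. i \<in> I \<Longrightarrow> x \<in> S2 \<Longrightarrow> sg i x = 0 \<longleftrightarrow> rp2_of x \<in> path_image (c i)"
    using arrangement_lifts[OF arr two] by metis
  interpret spherical_arrangement I sg gam by fact
  let ?V = "crossing_points I c"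
  have deg: "degree I x = card (incident I c (rp2_of x))" if "x \<in> S2" for x
    unfolding degree_def incident_def using zero that by metis
  have V: "vertices = {x \<in> S2. rp2_of x \<in> ?V}"
    unfolding vertices_def crossing_points_def using deg by auto
  have "?V \<subseteq> rp2_of ` vertices"
  proof
    fix p assume p: "p \<in> ?V"
    obtain x where "x \<in> S2" "p = rp2_of x" using rp2_of_surj by blast
    then show "p \<in> rp2_of ` vertices" using p V by auto
  qed
  then show fV: "finite ?V" using finite_vertices finite_surj by blast
  have fiber: "card {x \<in> vertices. rp2_of x = p} = 2" if p: "p \<in> ?V" for p
  proof -
    obtain x where x: "x \<in> S2" "p = rp2_of x" using rp2_of_surj by blast
    then have "{x \<in> vertices. rp2_of x = p} = {x, - x}"
      unfolding V using p rp2_of_eq_iff rp2_of_minus by auto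
    then show ?thesis using S2_neq_minus[OF x(1)] by simp
  qed
  have double: "(\<Sum>x\<in>vertices. f (rp2_of x)) = 2 * (\<Sum>p\<in>?V. f p)" for f :: "rp2 \<Rightarrow> nat"
  proof -
    have "(\<Sum>x\<in>vertices. f (rp2_of x)) = (\<Sum>p\<in>?V. \<Sum>x\<in>{x \<in> vertices. rp2_of x = p}. f (rp2_of x))"
      by (rule sum.group[OF finite_vertices fV, symmetric]) (use V in auto)
    also have "\<dots> = (\<Sum>p\<in>?V. 2 * f p)"
    proof (rule sum.cong)
      fix p assume p: "p \<in> ?V"
      have "(\<Sum>x\<in>{x \<in> vertices. rp2_of x = p}. f (rp2_of x)) = (\<Sum>x\<in>{x \<in> vertices. rp2_of x = p}. f p)"
        by (rule sum.cong) auto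
      then show "(\<Sum>x\<in>{x \<in> vertices. rp2_of x = p}. f (rp2_of x)) = 2 * f p" using fiber[OF p] by simp
    qed simp
    finally show ?thesis by (simp add: sum_distrib_left)
  qed
  have "\<exists>i\<in>I. sg i x \<noteq> 0" if "x \<in> S2" for x using nc zero that by blast
  then have "(\<Sum>v\<in>vertices. degree I v) + 6 \<le> 3 * card vertices" by (rule melchior)
  moreover have "(\<Sum>v\<in>vertices. degree I v) = 2 * (\<Sum>p\<in>?V. card (incident I c p))"
  proof -
    have "(\<Sum>v\<in>vertices. degree I v) = (\<Sum>v\<in>vertices. card (incident I c (rp2_of v)))"
      by (rule sum.cong) (use deg V in auto)
    then show ?thesis using double by simp
  qed
  moreover have "card vertices = 2 * card ?V" using double[of "\<lambda>_. 1"] by simp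
  ultimately show "(\<Sum>p\<in>?V. card (incident I c p)) + 3 \<le> 3 * card ?V" by linarith
qed


section \<open>Configurations\<close>

lemma rank_ge_card:
  assumes "finite S" "X \<subseteq> S" "indep X"
  shows "card X \<le> matroid_rank indep S"
proof -
  have "finite {card X |X. X \<subseteq> S \<and> indep X}"
    by (rule finite_subset[of _ "card ` Pow S"]) (use assms(1) in auto)
  then show ?thesis unfolding matroid_rank_def using assms by (intro Max_ge) auto
qed

lemma (in matroid) rank_attained:
  assumes "finite S"
  obtains X where "X \<subseteq> S" "indep X" "card X = matroid_rank indep S"
proof -
  have "finite {card X |X. X \<subseteq> S \<and> indep X}"
    by (rule finite_subset[of _ "card ` Pow S"]) (use assms in auto)
  moreover have "{card X |X. X \<subseteq> S \<and> indep X} \<noteq> {}" using indep_empty by auto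
  ultimately have "matroid_rank indep S \<in> {card X |X. X \<subseteq> S \<and> indep X}"
    unfolding matroid_rank_def by (rule Max_in)
  then show ?thesis using that by auto
qed

text \<open>Two curves through a crossing point give rank at least 2 by simplicity, and the common
  point gives rank at most 2. Maximality matches on both sides: a further element that kept the rank
  at 2 would force a common point, which two of the curves already determine.\<close>

lemma realization_lines:
  assumes sm: "simple_matroid E indep" and arr: "pseudoline_arrangement E c"
    and real: "\<And>S. S \<subseteq> E \<Longrightarrow> (\<exists>p. \<forall>i\<in>S. p \<in> path_image (c i)) \<longleftrightarrow> matroid_rank indep S \<le> 2"
  shows "bij_betw (incident E c) (crossing_points E c) (matroid_lines E indep)"
proof -
  interpret matroid E indep using sm by (simp add: simple_matroid_def)
  have fin: "finite S" if "S \<subseteq> E" for S using that finite_ground finite_subset by blast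
  have unique: "p = q" if "i \<in> E" "j \<in> E" "i \<noteq> j" "p \<in> path_image (c i)" "p \<in> path_image (c j)"
    "q \<in> path_image (c i)" "q \<in> path_image (c j)" for i j p q
  proof -
    obtain r where "path_image (c i) \<inter> path_image (c j) = {r}"
      using arr \<open>i \<in> E\<close> \<open>j \<in> E\<close> \<open>i \<noteq> j\<close> unfolding pseudoline_arrangement_def by blast
    then have "p \<in> {r}" "q \<in> {r}" using that by blast+
    then show ?thesis by simp
  qed
  have sub: "incident E c p \<subseteq> E" for p by (auto simp: incident_def)
  have pair: "\<exists>i\<in>S. \<exists>j\<in>S. i \<noteq> j" if "2 \<le> card S" for S :: "'a set"
    using that by (metis card_le_Suc0_iff_eq card.infinite not_less_eq_eq numeral_2_eq_2 zero_le)
  have rank2: "2 \<le> matroid_rank indep S" if S: "S \<subseteq> E" and c: "2 \<le> card S" for S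
  proof -
    obtain i j where ij: "i \<in> S" "j \<in> S" "i \<noteq> j" using pair[OF c] by auto
    then have "indep {i, j}" using sm S by (auto simp: simple_matroid_def)
    moreover have "card {i, j} = 2" using ij by simp
    ultimately show ?thesis using rank_ge_card[OF fin[OF S], of "{i, j}" indep] ij by simp
  qed
  show ?thesis
  proof (rule bij_betw_imageI)
    show "inj_on (incident E c) (crossing_points E c)"
    proof (rule inj_onI)
      fix p q assume p: "p \<in> crossing_points E c" and eq: "incident E c p = incident E c q"
      obtain i j where "i \<in> incident E c p" "j \<in> incident E c p" "i \<noteq> j"
        using pair p unfolding crossing_points_def by blast
      moreover then have "i \<in> incident E c q" "j \<in> incident E c q" using eq by auto
      ultimately show "p = q" using unique[of i j p q] by (auto simp: incident_def)
    qed
    show "incident E c ` crossing_points E c = matroid_lines E indep"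
    proof
      show "incident E c ` crossing_points E c \<subseteq> matroid_lines E indep"
      proof
        fix L assume "L \<in> incident E c ` crossing_points E c"
        then obtain p where p: "2 \<le> card (incident E c p)" "L = incident E c p"
          by (auto simp: crossing_points_def)
        have LE: "L \<subseteq> E" using sub p by simp
        have "matroid_rank indep L \<le> 2" using real[OF LE] p by (auto simp: incident_def)
        then have r: "matroid_rank indep L = 2" using rank2[OF LE] p by simp
        have "matroid_rank indep L < matroid_rank indep (insert x L)" if x: "x \<in> E - L" for x
        proof (rule ccontr)
          assume "\<not> matroid_rank indep L < matroid_rank indep (insert x L)"
          then have "matroid_rank indep (insert x L) \<le> 2" using r by simp
          moreover have "insert x L \<subseteq> E" using x LE by auto
          ultimately obtain q where q: "\<forall>i\<in>insert x L. q \<in> path_image (c i)" using real by blast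
          obtain i j where ij: "i \<in> L" "j \<in> L" "i \<noteq> j" using pair p by blast
          then have "q = p" using unique[of i j q p] q p by (auto simp: incident_def)
          then show False using q x p by (auto simp: incident_def)
        qed
        then show "L \<in> matroid_lines E indep" using LE r by (auto simp: matroid_lines_def flat_def)
      qed
      show "matroid_lines E indep \<subseteq> incident E c ` crossing_points E c"
      proof
        fix L assume "L \<in> matroid_lines E indep"
        then have LE: "L \<subseteq> E" and r: "matroid_rank indep L = 2"
          and fl: "\<And>x. x \<in> E - L \<Longrightarrow> 2 < matroid_rank indep (insert x L)"
          by (auto simp: matroid_lines_def flat_def)
        obtain p where p: "\<forall>i\<in>L. p \<in> path_image (c i)" using real[OF LE] r by auto
        have "L = incident E c p"
        proof (rule ccontr)
          assume "L \<noteq> incident E c p"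
          then obtain x where x: "x \<in> E - L" "p \<in> path_image (c x)"
            using p LE by (auto simp: incident_def)
          then have "matroid_rank indep (insert x L) \<le> 2" using real[of "insert x L"] p LE by auto
          then show False using fl[OF x(1)] by simp
        qed
        moreover obtain X where "X \<subseteq> L" "card X = 2" using rank_attained[OF fin[OF LE]] r by metis
        then have "2 \<le> card L" using card_mono[OF fin[OF LE]] by metis
        ultimately show "L \<in> incident E c ` crossing_points E c" by (auto simp: crossing_points_def)
      qed
    qed
  qed
qed

section \<open>Double counting and the bound\<close>

lemma card_ordered_pairs: "finite S \<Longrightarrow> card {(x, y). x \<in> S \<and> y \<in> S \<and> x \<noteq> y} = card S * (card S - 1)"
proof -
  assume "finite S"
  moreover have "{(x, y). x \<in> S \<and> y \<in> S \<and> x \<noteq> y} = Sigma S (\<lambda>x. S - {x})" by auto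
  ultimately show ?thesis by simp
qed

lemma sum_incident_pairs:
  assumes arr: "pseudoline_arrangement E c" and fin: "finite (crossing_points E c)"
  shows "(\<Sum>p\<in>crossing_points E c. card (incident E c p) * (card (incident E c p) - 1)) = card E * (card E - 1)"
proof -
  let ?P = "\<lambda>S. {(x, y). x \<in> S \<and> y \<in> S \<and> x \<noteq> y}"
  have fE: "finite E" using arr by (simp add: pseudoline_arrangement_def)
  have fi: "finite (incident E c p)" for p using fE by (simp add: incident_def)
  have meet: "\<exists>p. path_image (c i) \<inter> path_image (c j) = {p}" if "i \<in> E" "j \<in> E" "i \<noteq> j" for i j
    using arr that unfolding pseudoline_arrangement_def by blast
  have fP: "finite (?P S)" if "finite S" for S :: "'a set"
    by (rule finite_subset[of _ "S \<times> S"]) (use that in auto)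
  have "?P E = (\<Union>p\<in>crossing_points E c. ?P (incident E c p))"
  proof
    show "(\<Union>p\<in>crossing_points E c. ?P (incident E c p)) \<subseteq> ?P E" by (auto simp: incident_def)
    show "?P E \<subseteq> (\<Union>p\<in>crossing_points E c. ?P (incident E c p))"
    proof clarify
      fix i j assume ij: "i \<in> E" "j \<in> E" "i \<noteq> j"
      then obtain p where "path_image (c i) \<inter> path_image (c j) = {p}" using meet by blast
      then have "i \<in> incident E c p" "j \<in> incident E c p" using ij by (auto simp: incident_def)
      moreover then have "card {i, j} \<le> card (incident E c p)" by (intro card_mono fi) auto
      then have "p \<in> crossing_points E c" using ij(3) by (simp add: crossing_points_def)
      ultimately show "(i, j) \<in> (\<Union>p\<in>crossing_points E c. ?P (incident E c p))"
        using ij(3) by blast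
    qed
  qed
  moreover have "?P (incident E c p) \<inter> ?P (incident E c q) = {}" if "p \<noteq> q" for p q
  proof (rule ccontr)
    assume "?P (incident E c p) \<inter> ?P (incident E c q) \<noteq> {}"
    then obtain i j where ij: "i \<in> E" "j \<in> E" "i \<noteq> j" "p \<in> path_image (c i) \<inter> path_image (c j)"
        "q \<in> path_image (c i) \<inter> path_image (c j)" by (auto simp: incident_def)
    then obtain r where "path_image (c i) \<inter> path_image (c j) = {r}" using meet by blast
    then show False using that ij by (metis singletonD)
  qed
  ultimately have "card (?P E) = (\<Sum>p\<in>crossing_points E c. card (?P (incident E c p)))"
    using fin fi fP by (simp add: card_UN_disjoint)
  then show ?thesis using fE fi by (simp add: card_ordered_pairs)
qed

text \<open>Incidences between points and lines of size \<open>k\<close> are counted in both ways,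
  each side giving a factor \<open>k\<close>.\<close>

lemma nk_configuration_card_klines:
  assumes conf: "nk_configuration n k E indep" and k: "k > 0" and fin: "finite (matroid_lines E indep)"
  shows "card {L \<in> matroid_lines E indep. card L = k} = n"
proof -
  let ?K = "{L \<in> matroid_lines E indep. card L = k}"
  have cE: "card E = n" and deg: "\<And>x. x \<in> E \<Longrightarrow> card {L \<in> matroid_lines E indep. x \<in> L \<and> card L = k} = k"
    and fE: "finite E"
    using conf by (auto simp: nk_configuration_def simple_matroid_def matroid_def)
  have fK: "finite ?K" using fin by simp
  have KE: "L \<subseteq> E" if "L \<in> ?K" for L using that by (auto simp: matroid_lines_def flat_def)
  have "n * k = (\<Sum>x\<in>E. card {L \<in> ?K. x \<in> L})"
  proof -
    have "{L \<in> ?K. x \<in> L} = {L \<in> matroid_lines E indep. x \<in> L \<and> card L = k}" for x by auto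
    then show ?thesis using deg cE by simp
  qed
  also have "\<dots> = (\<Sum>x\<in>E. \<Sum>L\<in>?K. if x \<in> L then 1 else 0)"
    using fK by (simp add: sum.If_cases Int_def conj_commute)
  also have "\<dots> = (\<Sum>L\<in>?K. \<Sum>x\<in>E. if x \<in> L then 1 else 0)" by (rule sum.swap)
  also have "\<dots> = (\<Sum>L\<in>?K. k)"
  proof (rule sum.cong)
    fix L assume L: "L \<in> ?K"
    then have "E \<inter> L = L" using KE by auto
    then show "(\<Sum>x\<in>E. if x \<in> L then 1 else 0) = k" using L fE by (simp add: sum.If_cases)
  qed simp
  also have "\<dots> = card ?K * k" by simp
  finally show ?thesis using k by simp
qed

lemma pl_realizable_bound:
  assumes k: "k \<ge> 3" and n: "n > 0" and conf: "nk_configuration n k E indep" and pl: "pl_realizable E indep"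
  shows "int n > (int k)\<^sup>2 + int k - 5"
proof -
  obtain c where arr: "pseudoline_arrangement E c"
    and real: "\<And>S. S \<subseteq> E \<Longrightarrow> (\<exists>p. \<forall>i\<in>S. p \<in> path_image (c i)) \<longleftrightarrow> matroid_rank indep S \<le> 2"
    using pl unfolding pl_realizable_def by blast
  have sm: "simple_matroid E indep" and r3: "matroid_rank indep E = 3" and cE: "card E = n"
    using conf by (auto simp: nk_configuration_def)
  have nc: "\<exists>i\<in>E. p \<notin> path_image (c i)" for p using real[of E] r3 by auto
  let ?V = "crossing_points E c"
  let ?L = "matroid_lines E indep"
  note mel = pseudoline_melchior[OF arr nc]
  note bij = realization_lines[OF sm arr real]
  have fL: "finite ?L" using bij_betw_finite[OF bij] mel(1) by simp
  have V2: "2 \<le> card L" if "L \<in> ?L" for L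
  proof -
    have "L \<in> incident E c ` ?V" using that bij_betw_imp_surj_on[OF bij] by simp
    then obtain p where "p \<in> ?V" "L = incident E c p" by auto
    then show ?thesis by (simp add: crossing_points_def)
  qed
  have 1: "(\<Sum>L\<in>?L. card L) + 3 \<le> 3 * card ?L"
    using mel(2) sum.reindex_bij_betw[OF bij, of card] bij_betw_same_card[OF bij] by simp
  have 2: "(\<Sum>L\<in>?L. card L * (card L - 1)) = n * (n - 1)"
    using sum_incident_pairs[OF arr mel(1)] sum.reindex_bij_betw[OF bij, of "\<lambda>L. card L * (card L - 1)"] cE by simp
  let ?K = "{L \<in> ?L. card L = k}"
  \<comment> \<open>With m points this is (m - 2) (m + 3), nonnegative from m = 2 on. Its total is
    controlled by the pair count and Melchior's inequality; at m = k it is k^2 + k - 6.\<close>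
  define w where "w L = int (card L) * (int (card L) - 1) + 2 * int (card L) - 6" for L :: "'a set"
  have w0: "0 \<le> w L" if "L \<in> ?L" for L
  proof -
    have "2 * 1 \<le> int (card L) * (int (card L) - 1)" using V2[OF that] by (intro mult_mono) auto
    then show ?thesis using V2[OF that] by (simp add: w_def)
  qed
  have "int n * (int k * (int k - 1) + 2 * int k - 6) = (\<Sum>L\<in>?K. w L)"
    using nk_configuration_card_klines[OF conf _ fL] k by (simp add: w_def)
  also have "\<dots> \<le> (\<Sum>L\<in>?L. w L)" using fL w0 by (intro sum_mono2) auto
  also have "\<dots> = int (\<Sum>L\<in>?L. card L * (card L - 1)) + 2 * int (\<Sum>L\<in>?L. card L) - 6 * int (card ?L)"
  proof -
    have "w L = int (card L * (card L - 1)) + 2 * int (card L) - 6" if "L \<in> ?L" for L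
      using V2[OF that] by (simp add: w_def of_nat_diff)
    then have "(\<Sum>L\<in>?L. w L) = (\<Sum>L\<in>?L. int (card L * (card L - 1)) + 2 * int (card L) - 6)"
      by (rule sum.cong[OF refl])
    then show ?thesis by (simp add: sum.distrib sum_subtractf sum_distrib_left)
  qed
  \<comment> \<open>Melchior's inequality doubled; its 6 is what makes the next comparison
    strict.\<close>
  also have "\<dots> \<le> int (n * (n - 1)) - 6" using 1 unfolding 2 by linarith
  also have "\<dots> < int n * (int n - 1)" using n by (simp add: of_nat_diff)
  finally have "int k * (int k - 1) + 2 * int k - 6 < int n - 1" using n by simp
  then show ?thesis by (simp add: power2_eq_square algebra_simps)
qed

theorem mainTheorem2:
  "(\<forall>k n :: nat. k \<ge> 3 \<longrightarrow> n > 0 \<longrightarrow>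
      (\<exists>(E :: 'a set) indep. nk_configuration n k E indep \<and> pl_realizable E indep) \<longrightarrow>
      int n > (int k)\<^sup>2 + int k - 5)
   \<and> \<not> (\<exists>(E :: 'a set) indep. nk_configuration 15 4 E indep \<and> pl_realizable E indep)"
proof
  show bound: "\<forall>k n :: nat. k \<ge> 3 \<longrightarrow> n > 0 \<longrightarrow>
      (\<exists>(E :: 'a set) indep. nk_configuration n k E indep \<and> pl_realizable E indep) \<longrightarrow>
      int n > (int k)\<^sup>2 + int k - 5"
    using pl_realizable_bound by blast
  show "\<not> (\<exists>(E :: 'a set) indep. nk_configuration 15 4 E indep \<and> pl_realizable E indep)"
    \<comment> \<open>For k = 4 the bound k^2 + k - 5 is exactly 15, so strictness decides.\<close>
    using bound[rule_format, of 4 15] by auto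
qed

end
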